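(* Let $k \leq n$ be positive integers and let $\lambda = (\lambda_1 \geq \cdots \geq \lambda_s\ge0)$ be a partition of $k$ with $s$ parts. The set $\{ \delta_{\sigma} : \sigma \in \mathcal{OP}_{n,\lambda} \}$ is a harmonic basis of $R_{n,\lambda}$; that is, it is a basis of the harmonic space $V_{n,\lambda}$ (and hence its image in $R_{n,\lambda}$ is a basis of $R_{n,\lambda}$).
   Context: A partition of $k$ with $s$ parts is a weakly decreasing sequence of $s$ nonnegative integers (trailing zeros allowed) summing to $k$; $\lambda'=(\lambda'_1,\dots,\lambda'_n)$ is its conjugate padded with zeros. $e_d(S)$ is the degree $d$ elementary symmetric polynomial in $\{x_i:i\in S\}$ (zero if $d>|S|$). $I_{n,\lambda}\subseteq\mathbb{Q}[x_1,\dots,x_n]$ is generated by $x_1^s,\dots,x_n^s$ and all $e_d(S)$ with $S\subseteq[n]$, $d>|S|-\lambda'_n-\cdots-\lambda'_{n-|S|+1}$; $R_{n,\lambda}=\mathbb{Q}[x_1,\dots,x_n]/I_{n,\lambda}$. With $f\odot g=f(\partial/\partial x_1,\dots,\partial/\partial x_n)(g)$ and $\langle f,g\rangle$ the constant term of $f\odot g$, $V_{n,\lambda}=\{g:\langle f,g\rangle=0\ \forall f\in I_{n,\lambda}\}$; one has $\mathbb{Q}[x_1,\dots,x_n]=V_{n,\lambda}\oplus I_{n,\lambda}$. $\mathcal{OP}_{n,\lambda}$: sequences $\sigma=(B_1\mid\cdots\mid B_s)$ of subsets with $[n]=\bigsqcup B_i$, $|B_i|\ge\lambda_i$. Container: column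 $i$ has $\lambda_i$ top-justified boxes, rows numbered from the top; the box in row $j$ of column $i$ holds the $(\lambda_i-j+1)$-th smallest element of $B_i$; the remaining elements of $B_i$ are floating in block $i$. Coinversions $(i,j)$, $i<j$: (a) $i$ floating, $j$ in a block to the right, $j$ in container row 1; (b) $i$ not floating, $j$ in a block to the right, same container row; (c) $i$ not floating, $j$ in a block to the left, $j$ in the row directly below that of $i$. $c_i$ = number of $j>i$ with $(i,j)$ a coinversion, plus $p-1$ if $i$ is floating in block $p$; $\mathtt{code}(\sigma)=(c_1,\dots,c_n)$. $\mathtt{maxcode}(\sigma)=(a_1,\dots,a_n)$: $a_i=s-1$ if $i$ floating; $a_i=\lambda'_j-m$ if $i$ is the $m$-th smallest entry of container row $j$. $T(\sigma)$ is the column-strict injective tableau of shape $\lambda$ whose $j$-th column consists of the entries of container row $j$ of $\sigma$, increasing downward. For a column-strict injective tableau $T$ with entries in $[n]$: $\mathbf{x}(T)=\prod x_i^{b_i}$, $b_i$ = number of boxes below $i$ in its column if $i\in T$, else $s-1$; $C_T$ = permutations of $[n]$ stabilizing each column's entry set and fixing entries not in $T$; $\delta_T=\sum_{w\in C_T}\mathrm{sign}(w)\,w\cdot\mathbf{x}(T)$ ($\mathfrak{S}_n$ permutes subscripts). Finally $\delta_\sigma=(x_1^{a_1-c_1}\cdots x_n^{a_n-c_n})\odot\delta_{T(\sigma)}$ where $(c_i)=\mathtt{code}(\sigma)$, $(a_i)=\mathtt{maxcode}(\sigma)$ (one has $c_i\le a_i$). *)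

theory Defs
  imports
    "HOL-Library.Poly_Mapping"
    "HOL-Combinatorics.Permutations"
    "HOL-Algebra.Embedded_Algebras"
    "HOL-Algebra.QuotRing"
begin

section \<open>Polynomials\<close>

text \<open>
  A polynomial is a finitely supported map from exponent vectors to the rationals; its product is
  the convolution product of \<^theory>\<open>HOL-Library.Poly_Mapping\<close>. The type has variables
  \<open>x\<^sub>i\<close> for all natural numbers \<open>i\<close>; the ring \<open>\<rat>[x\<^sub>1, \<dots>, x\<^sub>n]\<close> is the carrier set
  \<open>polys n\<close>.
\<close>

type_synonym monom = "nat \<Rightarrow>\<^sub>0 nat"
type_synonym mpoly = "monom \<Rightarrow>\<^sub>0 rat"

definition Const :: "rat \<Rightarrow> mpoly" where
  "Const c = Poly_Mapping.single 0 c"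

definition Var :: "nat \<Rightarrow> mpoly" where
  "Var i = Poly_Mapping.single (Poly_Mapping.single i 1) 1"

definition polys :: "nat \<Rightarrow> mpoly set" where
  "polys n = {p. \<forall>m \<in> Poly_Mapping.keys p. Poly_Mapping.keys m \<subseteq> {1..n}}"

definition poly_ring :: "nat \<Rightarrow> mpoly ring" where
  "poly_ring n = \<lparr>carrier = polys n, monoid.mult = (*), one = 1, zero = 0, add = (+)\<rparr>"

definition scale :: "rat \<Rightarrow> mpoly \<Rightarrow> mpoly" where
  "scale c p = Const c * p"

lemma Const_add: "Const (a + b) = Const a + Const b"
  by (simp add: Const_def single_add)

lemma Const_mult: "Const (a * b) = Const a * Const b"
  by (simp add: Const_def mult_single)

lemma Const_1: "Const 1 = 1"
  by (simp add: Const_def)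

global_interpretation mpoly_vs: vector_space scale
  by unfold_locales
    (simp_all add: scale_def Const_add Const_mult Const_1 algebra_simps)

lemma polys_closed:
  "0 \<in> polys n" "1 \<in> polys n"
  "p \<in> polys n \<Longrightarrow> q \<in> polys n \<Longrightarrow> p + q \<in> polys n"
  "p \<in> polys n \<Longrightarrow> q \<in> polys n \<Longrightarrow> p * q \<in> polys n"
  "p \<in> polys n \<Longrightarrow> - p \<in> polys n"
proof -
  show "0 \<in> polys n" "1 \<in> polys n"
    by (simp_all add: polys_def)
  show "p + q \<in> polys n" if "p \<in> polys n" "q \<in> polys n"
    using that Poly_Mapping.keys_add[of p q] by (fastforce simp: polys_def)
  show "p * q \<in> polys n" if "p \<in> polys n" "q \<in> polys n"
  proof -
    have "Poly_Mapping.keys m \<subseteq> {1..n}" if m: "m \<in> Poly_Mapping.keys (p * q)" for m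
    proof -
      obtain a b where "m = a + b" "a \<in> Poly_Mapping.keys p" "b \<in> Poly_Mapping.keys q"
        using keys_mult[of p q] m by blast
      then show ?thesis
        using \<open>p \<in> polys n\<close> \<open>q \<in> polys n\<close> Poly_Mapping.keys_add[of a b]
        by (fastforce simp: polys_def)
    qed
    then show ?thesis by (simp add: polys_def)
  qed
  show "- p \<in> polys n" if "p \<in> polys n"
    using that by (simp add: polys_def keys_minus in_keys_iff)
qed

lemma cring_poly_ring: "cring (poly_ring n)"
proof (rule cringI)
  show "abelian_group (poly_ring n)"
    by (rule abelian_groupI)
      (auto simp: poly_ring_def polys_closed algebra_simps intro!: bexI[of _ "- x" for x])
  show "Group.comm_monoid (poly_ring n)"
    by (rule comm_monoidI) (auto simp: poly_ring_def polys_closed algebra_simps)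
qed (auto simp: poly_ring_def algebra_simps)

definition perm_act :: "(nat \<Rightarrow> nat) \<Rightarrow> mpoly \<Rightarrow> mpoly" where
  "perm_act w p = (\<Sum>m \<in> Poly_Mapping.keys p.
     Const (Poly_Mapping.lookup p m) *
       (\<Prod>i \<in> Poly_Mapping.keys m. Var (w i) ^ Poly_Mapping.lookup m i))"

text \<open>
  In \<open>pdiff i\<close>, a monomial not involving \<open>x\<^sub>i\<close> contributes the coefficient \<open>0\<close>, so the
  truncated subtraction of exponent vectors is harmless.
\<close>

definition pdiff :: "nat \<Rightarrow> mpoly \<Rightarrow> mpoly" where
  "pdiff i g = (\<Sum>m \<in> Poly_Mapping.keys g.
     Poly_Mapping.single (m - Poly_Mapping.single i 1)
       (Poly_Mapping.lookup g m * of_nat (Poly_Mapping.lookup m i)))"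

text \<open>
  The operator \<open>\<Prod>\<^sub>i (\<partial>/\<partial>x\<^sub>i)^(m\<^sub>i)\<close>; partial derivatives commute, so the order in which they
  are composed does not matter.
\<close>

definition monom_diff :: "monom \<Rightarrow> mpoly \<Rightarrow> mpoly" where
  "monom_diff m g =
     fold (\<lambda>i. pdiff i ^^ Poly_Mapping.lookup m i) (sorted_list_of_set (Poly_Mapping.keys m)) g"

definition poly_diff :: "mpoly \<Rightarrow> mpoly \<Rightarrow> mpoly" where
  "poly_diff f g = (\<Sum>m \<in> Poly_Mapping.keys f. scale (Poly_Mapping.lookup f m) (monom_diff m g))"

definition pairing :: "mpoly \<Rightarrow> mpoly \<Rightarrow> rat" where
  "pairing f g = Poly_Mapping.lookup (poly_diff f g) 0"

definition elem_sym :: "nat \<Rightarrow> nat set \<Rightarrow> mpoly" where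
  "elem_sym d S = (\<Sum>T | T \<subseteq> S \<and> card T = d. \<Prod>i \<in> T. Var i)"

section \<open>The ring and its harmonic space\<close>

text \<open>
  A partition is the list of its parts. The part \<open>\<lambda>\<^sub>i\<close> is \<open>lam ! (i - 1)\<close>, that is, list
  positions (hence also blocks and container columns below) are counted from \<open>0\<close>. Parts of the
  conjugate and container rows are counted from \<open>1\<close>.
\<close>

definition partition_with_parts :: "nat list \<Rightarrow> nat \<Rightarrow> nat \<Rightarrow> bool" where
  "partition_with_parts lam k s \<longleftrightarrow>
     length lam = s \<and> sorted_wrt (\<ge>) lam \<and> sum_list lam = k"

definition conjugate :: "nat list \<Rightarrow> nat \<Rightarrow> nat" where
  "conjugate lam j = card {i. i < length lam \<and> j \<le> lam ! i}"

text \<open>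
  The bound \<open>d > |S| - \<lambda>'\<^sub>n - \<dots> - \<lambda>'\<^sub>(n - |S| + 1)\<close> is written without subtraction.
\<close>

definition ideal_gens :: "nat \<Rightarrow> nat list \<Rightarrow> mpoly set" where
  "ideal_gens n lam =
     {Var i ^ length lam | i. i \<in> {1..n}} \<union>
     {elem_sym d S | d S. S \<subseteq> {1..n} \<and>
        card S < d + (\<Sum>j \<in> {n - card S + 1..n}. conjugate lam j)}"

definition I_ideal :: "nat \<Rightarrow> nat list \<Rightarrow> mpoly set" where
  "I_ideal n lam = genideal (poly_ring n) (ideal_gens n lam)"

definition R_ring :: "nat \<Rightarrow> nat list \<Rightarrow> mpoly set ring" where
  "R_ring n lam = poly_ring n Quot I_ideal n lam"

definition R_proj :: "nat \<Rightarrow> nat list \<Rightarrow> mpoly \<Rightarrow> mpoly set" where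
  "R_proj n lam f = I_ideal n lam +>\<^bsub>poly_ring n\<^esub> f"

definition harmonic_space :: "nat \<Rightarrow> nat list \<Rightarrow> mpoly set" where
  "harmonic_space n lam = {g \<in> polys n. \<forall>f \<in> I_ideal n lam. pairing f g = 0}"

text \<open>
  Rational bases of the quotient ring, whose elements are cosets: the field of scalars is the
  image of the constant polynomials, and independence and span are those of
  \<^theory>\<open>HOL-Algebra.Embedded_Algebras\<close>, which are formulated for lists of vectors.
\<close>

definition R_basis :: "nat \<Rightarrow> nat list \<Rightarrow> mpoly set set \<Rightarrow> bool" where
  "R_basis n lam B \<longleftrightarrow>
     (let K = R_proj n lam ` range Const in
       \<exists>us. set us = B \<and> ring.independent (R_ring n lam) K us \<and>
         ring.Span (R_ring n lam) K us = carrier (R_ring n lam))"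

section \<open>Ordered set partitions and containers\<close>

definition OP :: "nat \<Rightarrow> nat list \<Rightarrow> nat set list set" where
  "OP n lam = {\<sigma>. length \<sigma> = length lam \<and>
     (\<Union>p < length \<sigma>. \<sigma> ! p) = {1..n} \<and>
     (\<forall>p < length \<sigma>. \<forall>q < length \<sigma>. p \<noteq> q \<longrightarrow> \<sigma> ! p \<inter> \<sigma> ! q = {}) \<and>
     (\<forall>p < length \<sigma>. lam ! p \<le> card (\<sigma> ! p))}"

text \<open>
  \<open>in_box lam \<sigma> p r x\<close>: the box in column \<open>p\<close> and row \<open>r\<close> of the container holds \<open>x\<close>, the
  \<open>(\<lambda> - r + 1)\<close>-th smallest element of block \<open>p\<close>, where \<open>\<lambda> = lam ! p\<close> (list positions start at
  \<open>0\<close>).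
\<close>

definition in_box :: "nat list \<Rightarrow> nat set list \<Rightarrow> nat \<Rightarrow> nat \<Rightarrow> nat \<Rightarrow> bool" where
  "in_box lam \<sigma> p r x \<longleftrightarrow> p < length lam \<and> 1 \<le> r \<and> r \<le> lam ! p \<and>
     x = sorted_list_of_set (\<sigma> ! p) ! (lam ! p - r)"

definition floating_in :: "nat list \<Rightarrow> nat set list \<Rightarrow> nat \<Rightarrow> nat \<Rightarrow> bool" where
  "floating_in lam \<sigma> p x \<longleftrightarrow> p < length lam \<and> x \<in> \<sigma> ! p \<and> (\<nexists>r. in_box lam \<sigma> p r x)"

definition floating :: "nat list \<Rightarrow> nat set list \<Rightarrow> nat \<Rightarrow> bool" where
  "floating lam \<sigma> x \<longleftrightarrow> (\<exists>p. floating_in lam \<sigma> p x)"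

definition container_row :: "nat list \<Rightarrow> nat set list \<Rightarrow> nat \<Rightarrow> nat set" where
  "container_row lam \<sigma> r = {x. \<exists>p. in_box lam \<sigma> p r x}"

definition coinversion :: "nat list \<Rightarrow> nat set list \<Rightarrow> nat \<Rightarrow> nat \<Rightarrow> bool" where
  "coinversion lam \<sigma> i j \<longleftrightarrow> i < j \<and>
     ((\<exists>p q. floating_in lam \<sigma> p i \<and> p < q \<and> in_box lam \<sigma> q 1 j) \<or>
      (\<exists>p q r. in_box lam \<sigma> p r i \<and> p < q \<and> in_box lam \<sigma> q r j) \<or>
      (\<exists>p q r. in_box lam \<sigma> p r i \<and> q < p \<and> in_box lam \<sigma> q (r + 1) j))"

text \<open>
  As blocks are counted from \<open>0\<close>, the summand \<open>p - 1\<close> for a floating entry of the \<open>p\<close>-th block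
  is the position of that block.
\<close>

definition code :: "nat \<Rightarrow> nat list \<Rightarrow> nat set list \<Rightarrow> nat \<Rightarrow> nat" where
  "code n lam \<sigma> i = card {j \<in> {1..n}. coinversion lam \<sigma> i j} +
     (if floating lam \<sigma> i then THE p. floating_in lam \<sigma> p i else 0)"

definition maxcode :: "nat list \<Rightarrow> nat set list \<Rightarrow> nat \<Rightarrow> nat" where
  "maxcode lam \<sigma> i =
     (if floating lam \<sigma> i then length lam - 1
      else let r = (THE r. i \<in> container_row lam \<sigma> r)
           in conjugate lam r - card {x \<in> container_row lam \<sigma> r. x \<le> i})"

section \<open>Tableaux and the polynomials \<open>\<delta>\<close>\<close>

text \<open>
  A tableau maps the column index \<open>j \<ge> 1\<close> to the list of entries of that column, read from top to
  bottom (the empty list beyond the last column). Column \<open>j\<close> of \<open>T(\<sigma>)\<close> has \<open>\<lambda>'\<^sub>j\<close> entries.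
\<close>

type_synonym tableau = "nat \<Rightarrow> nat list"

definition entries :: "tableau \<Rightarrow> nat set" where
  "entries T = (\<Union>j. set (T j))"

definition tableau_of :: "nat list \<Rightarrow> nat set list \<Rightarrow> tableau" where
  "tableau_of lam \<sigma> j = sorted_list_of_set (container_row lam \<sigma> j)"

definition boxes_below :: "tableau \<Rightarrow> nat \<Rightarrow> nat" where
  "boxes_below T i = card {(j, q). q < length (T j) \<and> (\<exists>r < q. T j ! r = i)}"

definition x_monom :: "nat \<Rightarrow> nat \<Rightarrow> tableau \<Rightarrow> mpoly" where
  "x_monom n s T =
     (\<Prod>i \<in> {1..n}. Var i ^ (if i \<in> entries T then boxes_below T i else s - 1))"

definition column_group :: "nat \<Rightarrow> tableau \<Rightarrow> (nat \<Rightarrow> nat) set" where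
  "column_group n T =
     {w. w permutes {1..n} \<and> (\<forall>j. w ` set (T j) = set (T j)) \<and> (\<forall>i. i \<notin> entries T \<longrightarrow> w i = i)}"

definition delta_tableau :: "nat \<Rightarrow> nat \<Rightarrow> tableau \<Rightarrow> mpoly" where
  "delta_tableau n s T =
     (\<Sum>w \<in> column_group n T. scale (of_int (sign w)) (perm_act w (x_monom n s T)))"

definition delta :: "nat \<Rightarrow> nat list \<Rightarrow> nat set list \<Rightarrow> mpoly" where
  "delta n lam \<sigma> =
     poly_diff (\<Prod>i \<in> {1..n}. Var i ^ (maxcode lam \<sigma> i - code n lam \<sigma> i))
       (delta_tableau n (length lam) (tableau_of lam \<sigma>))"

end

theory Submission
  imports Defs
begin

text \<open>
  Order monomials lexicographically with \<open>x\<^sub>1 > x\<^sub>2 > \<dots>\<close>. The polynomial \<open>\<delta>\<^sub>T\<close> is a signed sum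
  of permuted monomials whose largest term is the unpermuted one, with exponent vector
  \<open>maxcode(\<sigma>)\<close>; differentiating shifts exponents, so the leading monomial of \<open>\<delta>\<^sub>\<sigma>\<close> is
  \<open>x^code(\<sigma>)\<close>. Since codes are injective, the \<open>\<delta>\<^sub>\<sigma>\<close> are linearly independent. They are harmonic:
  \<open>e\<^sub>d(S) \<odot> \<delta>\<^sub>T\<close> is antisymmetric in every column contained in \<open>S\<close>, hence has distinct exponents
  there, which is impossible for degree reasons unless the derivative vanishes. Conversely, the
  leading monomial of every harmonic polynomial is a code: removing the smallest variable by
  taking the highest coefficient decreases one part of \<open>\<lambda>\<close>, and the same recursion holds for codes
  when the smallest entry is removed from its block. Here \<open>\<lambda>\<close> has to be an arbitrary composition.
\<close>

text \<open>No dimension count for R enters: independence comes from codes being distinct, spanning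
  from every leading monomial of V being a code. What links the two recursions is
  \<open>rank\<close>. In a leading monomial the exponent i of the smallest variable x is below s,
  because x^s kills harmonic polynomials, and \<open>rank\<close> maps the s blocks bijectively onto
  0, ..., s - 1; the block p of rank i is the one whose part is lowered. The algebraic side only
  asks that at most i parts exceed \<alpha>_p. It is indifferent to the order among equal parts, and
  the tie-break is dictated by the coinversion rules. For the harmonicity of
  \<open>\<delta>_T\<close>: on a container row with c entries, maxcode takes the values c - 1, ...,
  0, the least possible sum of c distinct exponents. So a term surviving e_d(S) cannot have lost a
  degree in any variable of a row inside S, and these rows leave too few elements of S for a
  squarefree monomial of degree d.\<close>

abbreviation lookup :: "('a \<Rightarrow>\<^sub>0 'b::zero) \<Rightarrow> 'a \<Rightarrow> 'b" where "lookup \<equiv> Poly_Mapping.lookup"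
abbreviation keys :: "('a \<Rightarrow>\<^sub>0 'b::zero) \<Rightarrow> 'a set" where "keys \<equiv> Poly_Mapping.keys"
abbreviation single :: "'a \<Rightarrow> 'b \<Rightarrow> 'a \<Rightarrow>\<^sub>0 'b::zero" where "single \<equiv> Poly_Mapping.single"

section \<open>The action by differentiation\<close>

definition mfact :: "monom \<Rightarrow> rat" where
  "mfact m = (\<Prod>i\<in>keys m. fact (lookup m i))"

text \<open>
  Coefficients with respect to the divided powers \<open>x\<^sup>m / m!\<close>, on which differentiation acts by
  a shift of the exponent.
\<close>

definition dcoef :: "mpoly \<Rightarrow> monom \<Rightarrow> rat" where
  "dcoef g m = lookup g m * mfact m"

lemma mfact_superset: "finite A \<Longrightarrow> keys m \<subseteq> A \<Longrightarrow> mfact m = (\<Prod>i\<in>A. fact (lookup m i))"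
  unfolding mfact_def by (rule prod.mono_neutral_left) (auto simp: in_keys_iff)

lemma mfact_pos: "mfact m > 0"
  by (simp add: mfact_def prod_pos)

lemma mfact_nonzero [simp]: "mfact m \<noteq> 0"
  using mfact_pos[of m] by simp

lemma mfact_0 [simp]: "mfact 0 = 1"
  by (simp add: mfact_def)

lemma mfact_add_single: "mfact (m + single i 1) = mfact m * of_nat (lookup m i + 1)"
proof -
  have "mfact (m + single i 1) = (\<Prod>j\<in>insert i (keys m). fact (lookup (m + single i 1) j))"
    by (rule mfact_superset) (use Poly_Mapping.keys_add[of m "single i 1"] in auto)
  also have "\<dots> = fact (lookup m i + 1) * (\<Prod>j\<in>keys m - {i}. fact (lookup m j))"
    by (subst prod.insert_remove)
       (auto simp: lookup_add lookup_single when_def intro!: prod.cong)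
  also have "\<dots> = of_nat (lookup m i + 1) * (\<Prod>j\<in>insert i (keys m). fact (lookup m j))"
    by (subst prod.insert_remove) (simp_all add: algebra_simps)
  also have "(\<Prod>j\<in>insert i (keys m). fact (lookup m j)) = mfact m"
    by (rule mfact_superset[symmetric]) auto
  finally show ?thesis by (simp add: mult.commute)
qed

lemma dcoef_eqI: "(\<And>m. dcoef f m = dcoef g m) \<Longrightarrow> f = g"
  by (rule poly_mapping_eqI) (metis dcoef_def mfact_nonzero mult_right_cancel)

lemma dcoef_eq_0_iff [simp]: "dcoef g m = 0 \<longleftrightarrow> m \<notin> keys g"
  by (simp add: dcoef_def in_keys_iff)

lemma dcoef_0 [simp]: "dcoef 0 m = 0"
  by simp

lemma dcoef_add: "dcoef (f + g) m = dcoef f m + dcoef g m"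
  by (simp add: dcoef_def lookup_add algebra_simps)

lemma dcoef_diff: "dcoef (f - g) m = dcoef f m - dcoef g m"
  by (simp add: dcoef_def lookup_minus algebra_simps)

lemma dcoef_sum: "dcoef (sum f A) m = (\<Sum>a\<in>A. dcoef (f a) m)"
  by (simp add: dcoef_def lookup_sum sum_distrib_right)

lemma lookup_scale: "lookup (scale c g) m = c * lookup g m"
proof -
  have "scale c g = Poly_Mapping.map ((*) c) g"
    by (simp add: scale_def Const_def mult_map_scale_conv_mult)
  then show ?thesis by (simp add: Poly_Mapping.map.rep_eq when_def)
qed

lemma dcoef_scale: "dcoef (scale c g) m = c * dcoef g m"
  by (simp add: dcoef_def lookup_scale)

lemma dcoef_pdiff: "dcoef (pdiff i g) m = dcoef g (m + single i 1)"
proof -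
  have *: "lookup (single (k - single i 1) (lookup g k * of_nat (lookup k i))) m
      = (if k = m + single i 1 then lookup g k * of_nat (lookup m i + 1) else 0)" for k :: monom
  proof (cases "lookup k i = 0")
    case True
    then have "k \<noteq> m + single i 1"
      by (auto simp: lookup_add)
    with True show ?thesis by simp
  next
    case False
    then have "k = (k - single i 1) + single i 1"
      by (intro poly_mapping_eqI) (auto simp: lookup_add lookup_minus lookup_single when_def)
    then have "k - single i 1 = m \<longleftrightarrow> k = m + single i 1"
      by (metis add_right_cancel)
    then show ?thesis by (auto simp: lookup_single lookup_add when_def)
  qed
  have "lookup (pdiff i g) m = (\<Sum>k\<in>keys g.
      if k = m + single i 1 then lookup g k * of_nat (lookup m i + 1) else 0)"
    by (simp only: pdiff_def lookup_sum *)
  also have "\<dots> = lookup g (m + single i 1) * of_nat (lookup m i + 1)"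
    by (subst sum.delta) (auto simp: in_keys_iff)
  finally show ?thesis
    unfolding dcoef_def mfact_add_single by (simp only: mult_ac)
qed

lemma dcoef_pdiff_pow: "dcoef ((pdiff i ^^ e) g) m = dcoef g (m + single i e)"
  by (induction e arbitrary: m)
     (simp_all add: dcoef_pdiff add.assoc flip: single_add)

lemma dcoef_monom_diff: "dcoef (monom_diff a g) m = dcoef g (m + a)"
proof -
  have *: "dcoef (fold (\<lambda>i. pdiff i ^^ lookup a i) xs g) m =
      dcoef g (m + (\<Sum>i\<leftarrow>xs. single i (lookup a i)))" for xs m
    by (induction xs arbitrary: m g) (simp_all add: dcoef_pdiff_pow add_ac)
  have "(\<Sum>i\<leftarrow>sorted_list_of_set (keys a). single i (lookup a i)) = (\<Sum>i\<in>keys a. single i (lookup a i))"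
    by (subst sum_list_distinct_conv_sum_set) auto
  also have "\<dots> = a"
    by (rule poly_mapping_eqI) (auto simp: lookup_sum lookup_single when_def in_keys_iff)
  finally show ?thesis by (simp add: monom_diff_def *)
qed

text \<open>The larger index set allows sums over different supports to be compared
  termwise.\<close>

lemma dcoef_poly_diff_superset:
  assumes "finite A" "keys f \<subseteq> A"
  shows "dcoef (poly_diff f g) m = (\<Sum>a\<in>A. lookup f a * dcoef g (m + a))"
proof -
  have "dcoef (poly_diff f g) m = (\<Sum>a\<in>keys f. lookup f a * dcoef g (m + a))"
    by (simp add: poly_diff_def dcoef_sum dcoef_scale dcoef_monom_diff)
  also have "\<dots> = (\<Sum>a\<in>A. lookup f a * dcoef g (m + a))"
    using assms by (intro sum.mono_neutral_left) (auto simp: in_keys_iff)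
  finally show ?thesis .
qed

lemmas dcoef_poly_diff = dcoef_poly_diff_superset[OF finite_keys subset_refl]

lemma poly_diff_0_left [simp]: "poly_diff 0 g = 0"
  by (simp add: poly_diff_def)

lemma poly_diff_0_right [simp]: "poly_diff f 0 = 0"
  by (rule dcoef_eqI) (simp add: dcoef_poly_diff)

lemma poly_diff_add_left: "poly_diff (f + h) g = poly_diff f g + poly_diff h g"
proof (rule dcoef_eqI)
  fix m
  have "keys (f + h) \<subseteq> keys f \<union> keys h" by (rule Poly_Mapping.keys_add)
  then show "dcoef (poly_diff (f + h) g) m = dcoef (poly_diff f g + poly_diff h g) m"
    unfolding dcoef_add
    by (subst (1 2 3) dcoef_poly_diff_superset[where A = "keys f \<union> keys h"])
       (auto simp: lookup_add algebra_simps sum.distrib)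
qed

lemma poly_diff_add_right: "poly_diff f (g + h) = poly_diff f g + poly_diff f h"
  by (rule dcoef_eqI) (simp add: dcoef_poly_diff dcoef_add algebra_simps sum.distrib)

lemma poly_diff_uminus_left: "poly_diff (- f) g = - poly_diff f g"
  using poly_diff_add_left[of f "- f" g] by (simp add: add_eq_0_iff)

lemma poly_diff_diff_left: "poly_diff (f - h) g = poly_diff f g - poly_diff h g"
  using poly_diff_add_left[of "f - h" h g] by simp

lemma poly_diff_diff_right: "poly_diff f (g - h) = poly_diff f g - poly_diff f h"
  using poly_diff_add_right[of f "g - h" h] by simp

lemma poly_diff_scale_right: "poly_diff f (scale c g) = scale c (poly_diff f g)"
  by (rule dcoef_eqI) (simp add: dcoef_poly_diff dcoef_scale sum_distrib_left mult_ac)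

lemma poly_diff_sum_left: "poly_diff (sum f A) g = (\<Sum>a\<in>A. poly_diff (f a) g)"
  by (induction A rule: infinite_finite_induct) (simp_all add: poly_diff_add_left)

lemma dcoef_poly_diff_single: "dcoef (poly_diff (single a c) g) m = c * dcoef g (m + a)"
  by (subst dcoef_poly_diff_superset[where A = "{a}"]) auto

lemma mpoly_eq_sum_single: "f = (\<Sum>a\<in>keys f. single a (lookup f a))"
  by (rule poly_mapping_eqI) (auto simp: lookup_sum lookup_single when_def in_keys_iff)

text \<open>Shifts of exponents compose additively. Polynomials thus act as commuting operators, and
  annihilators are ideals.\<close>

lemma poly_diff_mult: "poly_diff (f * h) g = poly_diff f (poly_diff h g)"
proof -
  have *: "poly_diff (single a c * h) g = poly_diff (single a c) (poly_diff h g)" for a c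
  proof -
    have "poly_diff (single a c * h) g = (\<Sum>b\<in>keys h. poly_diff (single a c * single b (lookup h b)) g)"
      by (subst mpoly_eq_sum_single[of h]) (simp add: sum_distrib_left poly_diff_sum_left)
    also have "\<dots> = poly_diff (single a c) (poly_diff h g)"
      by (rule dcoef_eqI)
         (simp add: mult_single dcoef_sum dcoef_poly_diff_single dcoef_poly_diff[of h]
           sum_distrib_left mult_ac add_ac)
    finally show ?thesis .
  qed
  have "poly_diff (f * h) g = (\<Sum>a\<in>keys f. poly_diff (single a (lookup f a) * h) g)"
    by (subst mpoly_eq_sum_single[of f]) (simp add: sum_distrib_right poly_diff_sum_left)
  also have "\<dots> = poly_diff f (poly_diff h g)"
    by (simp add: * flip: poly_diff_sum_left mpoly_eq_sum_single)
  finally show ?thesis .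
qed

lemma poly_diff_commute: "poly_diff f (poly_diff h g) = poly_diff h (poly_diff f g)"
  by (metis mult.commute poly_diff_mult)

section \<open>The pairing as a positive definite symmetric form\<close>

lemma pairing_eq_dcoef: "pairing f g = dcoef (poly_diff f g) 0"
  by (simp add: pairing_def dcoef_def)

lemma pairing_eq_sum: "pairing f g = (\<Sum>a\<in>keys f. lookup f a * dcoef g a)"
  by (simp add: pairing_eq_dcoef dcoef_poly_diff)

text \<open>Distinct monomials are orthogonal, and x^m paired with itself gives m!.\<close>

lemma pairing_commute: "pairing f g = pairing g f"
proof -
  have "pairing f g = (\<Sum>a\<in>keys f \<union> keys g. lookup f a * dcoef g a)" for f g
    unfolding pairing_eq_sum by (rule sum.mono_neutral_left) (auto simp: in_keys_iff)
  then show ?thesis by (simp add: dcoef_def Un_commute mult_ac)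
qed

text \<open>The value is a sum of squares of rational coefficients weighted by m! > 0. This
  definiteness is what makes V and I complementary.\<close>

lemma pairing_self_eq_0: "pairing f f = 0 \<Longrightarrow> f = 0"
proof (rule ccontr)
  assume "f \<noteq> 0" "pairing f f = 0"
  have "0 < (\<Sum>a\<in>keys f. lookup f a * dcoef f a)"
  proof (rule sum_pos)
    show "0 < lookup f a * dcoef f a" if "a \<in> keys f" for a
    proof -
      have "0 < (lookup f a)\<^sup>2" using that by (simp add: in_keys_iff)
      then have "0 < (lookup f a)\<^sup>2 * mfact a" using mfact_pos by (rule mult_pos_pos)
      then show ?thesis by (simp add: dcoef_def power2_eq_square mult.assoc)
    qed
  qed (use \<open>f \<noteq> 0\<close> in auto)
  then show False using \<open>pairing f f = 0\<close> by (simp add: pairing_eq_sum)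
qed

lemma pairing_add_right: "pairing f (g + h) = pairing f g + pairing f h"
  by (simp add: pairing_eq_dcoef poly_diff_add_right dcoef_add)

lemma pairing_diff_right: "pairing f (g - h) = pairing f g - pairing f h"
  by (simp add: pairing_eq_dcoef poly_diff_diff_right dcoef_diff)

lemma pairing_diff_left: "pairing (f - h) g = pairing f g - pairing h g"
  by (simp add: pairing_eq_dcoef poly_diff_diff_left dcoef_diff)

lemma pairing_scale_right: "pairing f (scale c g) = c * pairing f g"
  by (simp add: pairing_eq_dcoef poly_diff_scale_right dcoef_scale)

lemma pairing_scale_left: "pairing (scale c f) g = c * pairing f g"
  by (metis pairing_commute pairing_scale_right)

lemma pairing_0_left [simp]: "pairing 0 g = 0"
  by (simp add: pairing_eq_dcoef)

lemma pairing_0_right [simp]: "pairing f 0 = 0"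
  by (simp add: pairing_eq_dcoef)

text \<open>Every coefficient of f \<odot> g is a pairing with a multiple of f, so being orthogonal
  to an ideal amounts to being annihilated by it.\<close>

lemma dcoef_poly_diff_eq_pairing: "dcoef (poly_diff f g) m = pairing (single m 1 * f) g"
  by (simp add: pairing_eq_dcoef poly_diff_mult dcoef_poly_diff_single)

section \<open>Harmonic polynomials over an arbitrary set of variables\<close>

definition polys_on :: "nat set \<Rightarrow> mpoly set" where
  "polys_on X = {p. \<forall>m\<in>keys p. keys m \<subseteq> X}"

text \<open>The number of boxes of \<alpha> below row c, i.e. the sum of the conjugate parts beyond
  the c-th. With c = |X - S| this is the amount subtracted in the degree bound for e_d(S).\<close>

definition tail :: "nat list \<Rightarrow> nat \<Rightarrow> nat" where
  "tail \<alpha> c = (\<Sum>p<length \<alpha>. \<alpha> ! p - c)"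

text \<open>
  The size of \<open>\<alpha>\<close> may exceed the number of variables, in which case the space is zero because
  \<open>e\<^sub>0 = 1\<close> is among the generators.
\<close>

definition harmonic_on :: "nat set \<Rightarrow> nat list \<Rightarrow> mpoly set" where
  "harmonic_on X \<alpha> = {g \<in> polys_on X.
     (\<forall>i\<in>X. poly_diff (Var i ^ length \<alpha>) g = 0) \<and>
     (\<forall>S d. S \<subseteq> X \<longrightarrow> card S < d + tail \<alpha> (card (X - S)) \<longrightarrow> poly_diff (elem_sym d S) g = 0)}"

section \<open>Polynomials over X; recursions for \<open>elem_sym\<close> and
  \<open>tail\<close>\<close>

lemma polys_eq_polys_on: "polys n = polys_on {1..n}"
  by (simp add: polys_def polys_on_def)

lemma polys_on_0 [simp]: "0 \<in> polys_on X"
  by (simp add: polys_on_def)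

lemma polys_on_add: "p \<in> polys_on X \<Longrightarrow> q \<in> polys_on X \<Longrightarrow> p + q \<in> polys_on X"
  using Poly_Mapping.keys_add[of p q] by (fastforce simp: polys_on_def)

lemma keys_scale: "keys (scale c p) = (if c = 0 then {} else keys p)"
  by (auto simp: in_keys_iff lookup_scale)

lemma polys_on_scale: "p \<in> polys_on X \<Longrightarrow> scale c p \<in> polys_on X"
  by (simp add: polys_on_def keys_scale)

lemma keys_add_nat: "keys (a + b) = keys a \<union> keys b" for a b :: monom
  by (auto simp: in_keys_iff lookup_add)

lemma polys_on_poly_diff:
  assumes "g \<in> polys_on X"
  shows "poly_diff f g \<in> polys_on X"
  unfolding polys_on_def
proof safe
  fix m i assume "m \<in> keys (poly_diff f g)" and i: "i \<in> keys m"
  then have "dcoef (poly_diff f g) m \<noteq> 0" by simp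
  then obtain a where "dcoef g (m + a) \<noteq> 0"
    unfolding dcoef_poly_diff by (metis (no_types, lifting) mult_zero_right sum.neutral)
  then have "m + a \<in> keys g" by simp
  with assms have "keys (m + a) \<subseteq> X" by (auto simp: polys_on_def)
  with i show "i \<in> X" by (auto simp: keys_add_nat)
qed

lemma Var_power: "Var i ^ e = single (single i e) 1"
  by (induction e) (simp_all add: Var_def mult_single flip: single_add)

lemma prod_Var_power:
  "finite A \<Longrightarrow> (\<Prod>i\<in>A. Var (f i) ^ e i) = single (\<Sum>i\<in>A. single (f i) (e i)) 1"
  by (induction A rule: finite_induct) (simp_all add: Var_power mult_single)

lemma elem_sym_0: "finite S \<Longrightarrow> elem_sym 0 S = 1"
proof -
  assume "finite S"
  then have "{T. T \<subseteq> S \<and> card T = 0} = {{}}"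
    by (auto dest: finite_subset)
  then show ?thesis by (simp add: elem_sym_def)
qed

lemma elem_sym_insert:
  assumes "finite S" "x \<notin> S"
  shows "elem_sym (Suc d) (insert x S) = elem_sym (Suc d) S + Var x * elem_sym d S"
proof -
  let ?A = "{T. T \<subseteq> S \<and> card T = Suc d}" and ?B = "{T. T \<subseteq> S \<and> card T = d}"
  have fin: "finite T" if "T \<subseteq> S" for T using that assms(1) by (rule finite_subset)
  have "{T. T \<subseteq> insert x S \<and> card T = Suc d} = ?A \<union> insert x ` ?B"
  proof (intro equalityI subsetI)
    fix T assume T: "T \<in> {T. T \<subseteq> insert x S \<and> card T = Suc d}"
    show "T \<in> ?A \<union> insert x ` ?B"
    proof (cases "x \<in> T")
      case True
      then have "T = insert x (T - {x})" "T - {x} \<in> ?B" using T by auto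
      then show ?thesis by blast
    qed (use T in auto)
  next
    fix T assume "T \<in> ?A \<union> insert x ` ?B"
    then show "T \<in> {T. T \<subseteq> insert x S \<and> card T = Suc d}"
      using assms(2) fin by (auto simp: card_insert_if)
  qed
  moreover have "?A \<inter> insert x ` ?B = {}" "inj_on (insert x) ?B"
    using assms(2) by (auto intro!: inj_onI)
  moreover have "(\<Prod>i\<in>insert x T. Var i) = Var x * (\<Prod>i\<in>T. Var i)" if "T \<in> ?B" for T
    using that assms(2) fin by (subst prod.insert) auto
  ultimately show ?thesis
    using assms(1) by (simp add: elem_sym_def sum.union_disjoint sum.reindex sum_distrib_left)
qed

text \<open>The difference is the length of row c of the diagram.\<close>

lemma tail_pred:
  assumes "0 < c"
  shows "tail \<alpha> (c - 1) = tail \<alpha> c + card {q. q < length \<alpha> \<and> c \<le> \<alpha> ! q}"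
proof -
  have "card {q. q < length \<alpha> \<and> c \<le> \<alpha> ! q} = (\<Sum>q<length \<alpha>. if c \<le> \<alpha> ! q then 1 else 0)"
    by (simp add: sum.If_cases) (rule arg_cong[where f = card], auto)
  then show ?thesis
    unfolding tail_def using assms by (auto simp flip: sum.distrib intro!: sum.cong)
qed

text \<open>The lowest box of column p is lost, and it is counted below row c - 1 exactly if
  \<alpha>_p is at least c.\<close>

lemma tail_decrement:
  assumes "0 < c" "p < length \<alpha>"
  shows "tail (\<alpha>[p := \<alpha> ! p - 1]) (c - 1) + (if c \<le> \<alpha> ! p then 1 else 0) = tail \<alpha> (c - 1)"
proof -
  have *: "{..<length \<alpha>} = insert p ({..<length \<alpha>} - {p})" using assms by auto
  have "(\<Sum>q\<in>{..<length \<alpha>} - {p}. \<alpha>[p := \<alpha> ! p - 1] ! q - (c - 1)) =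
      (\<Sum>q\<in>{..<length \<alpha>} - {p}. \<alpha> ! q - (c - 1))"
    by (rule sum.cong) auto
  then show ?thesis
    unfolding tail_def length_list_update using assms
    by (subst (1 2) *) (subst (1 2) sum.insert, auto)
qed

text \<open>
  The highest coefficient of a harmonic polynomial with respect to one variable \<open>x\<^sub>m\<close> is again
  harmonic, for a composition in which one part is decreased. Dually, this is the recursion for the
  quotients of the filtration of the ring by powers of \<open>x\<^sub>m\<close>.
\<close>

lemma harmonic_on_top_coefficient:
  assumes X: "finite X" and m: "m \<in> X" and g: "g \<in> harmonic_on X \<alpha>"
    and top: "poly_diff (Var m) (poly_diff (Var m ^ i) g) = 0"
    and p: "p < length \<alpha>" and i: "card {q. q < length \<alpha> \<and> \<alpha> ! p < \<alpha> ! q} \<le> i"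
  shows "poly_diff (Var m ^ i) g \<in> harmonic_on (X - {m}) (\<alpha>[p := \<alpha> ! p - 1])" (is "?h \<in> _")
proof -
  note comm = poly_diff_commute[of _ "Var m ^ i" g]
  have gen: "poly_diff (elem_sym d S) g = 0" if "S \<subseteq> X" "card S < d + tail \<alpha> (card (X - S))" for S d
    using g that by (auto simp: harmonic_on_def)
  have "?h \<in> polys_on (X - {m})"
    unfolding polys_on_def mem_Collect_eq
  proof
    fix a assume a: "a \<in> keys ?h"
    have "?h \<in> polys_on X" using g by (simp add: harmonic_on_def polys_on_poly_diff)
    with a have "keys a \<subseteq> X" by (auto simp: polys_on_def)
    moreover have "m \<notin> keys a"
    proof
      assume "m \<in> keys a"
      then have "a = (a - single m 1) + single m 1"
        by (intro poly_mapping_eqI) (auto simp: lookup_add lookup_minus lookup_single when_def in_keys_iff)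
      then have "dcoef (poly_diff (Var m) ?h) (a - single m 1) = dcoef ?h a"
        unfolding Var_def dcoef_poly_diff_single by simp
      then show False using top a by simp
    qed
    ultimately show "keys a \<subseteq> X - {m}" by blast
  qed
  moreover have "poly_diff (Var j ^ length \<alpha>) ?h = 0" if "j \<in> X" for j
    using g that by (subst comm) (auto simp: harmonic_on_def)
  moreover have "poly_diff (elem_sym d S) ?h = 0"
    if S: "S \<subseteq> X - {m}" and d: "card S < d + tail (\<alpha>[p := \<alpha> ! p - 1]) (card (X - {m} - S))" for S d
  proof -
    have fin: "finite S" "m \<notin> S" and SX: "S \<subseteq> X" "insert m S \<subseteq> X"
      using S X m by (auto dest: finite_subset)
    \<comment> \<open>As m is not in S, the number of missing variables is c for S in X, but c - 1
      both for S in X - {m} and for \<open>insert m S\<close> in X.\<close>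
    define c where "c = card (X - S)"
    have "m \<in> X - S" using m fin by auto
    then have c: "0 < c" using X by (auto simp: c_def card_gt_0_iff)
    have *: "X - insert m S = X - S - {m}" "X - {m} - S = X - S - {m}" by auto
    have "card (X - S - {m}) = c - 1"
      unfolding c_def by (rule card_Diff_singleton) (use m fin in auto)
    then have c1: "card (X - insert m S) = c - 1" "card (X - {m} - S) = c - 1"
      by (simp_all add: *)
    show ?thesis
    proof (cases "c \<le> \<alpha> ! p")
      \<comment> \<open>Here the bound for S over X - {m} is the bound for \<open>insert m S\<close>
        over X in the same degree: both sides grow by one. In e_d(S) + x_m e_{d-1}(S) the second
        term kills \<open>?h\<close> by \<open>top\<close>.\<close>
      case True
      then have "card (insert m S) < d + tail \<alpha> (card (X - insert m S))"
        using d tail_decrement[OF c p] fin by (simp add: c1)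
      then have 0: "poly_diff (elem_sym d (insert m S)) g = 0" using SX gen by blast
      show ?thesis
      proof (cases d)
        case 0
        then show ?thesis using \<open>poly_diff (elem_sym d (insert m S)) g = 0\<close> fin
          by (subst comm) (simp add: elem_sym_0)
      next
        case (Suc d')
        have "poly_diff (elem_sym d (insert m S)) ?h = 0"
          using 0 by (subst comm) simp
        moreover have "poly_diff (Var m * elem_sym d' S) ?h = 0"
          using top by (subst mult.commute) (simp add: poly_diff_mult)
        ultimately show ?thesis
          using fin by (simp add: Suc elem_sym_insert poly_diff_add_left)
      qed
    next
      case False
      \<comment> \<open>Now the lowered part does not affect \<open>tail\<close>, so the bound
        covers e_k of \<open>insert m S\<close> only for k > d. Expanding it as e_k(S) + x_m
        e_{k-1}(S) trades one degree of e for one factor x_m; r such trades lead from e_{d+r}(S) to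
        x_m^r e_d(S).\<close>
      have red: "poly_diff (Var m ^ (j + r) * elem_sym d S) g = 0"
        if "poly_diff (Var m ^ j * elem_sym (d + r) S) g = 0" for j r
        using that
      proof (induction r arbitrary: j)
        case (Suc r)
        have "card (insert m S) < d + Suc r + tail \<alpha> (card (X - insert m S))"
          using d tail_decrement[OF c p] fin False by (simp add: c1)
        then have "poly_diff (elem_sym (d + Suc r) (insert m S)) g = 0" using SX gen by blast
        then have "poly_diff (Var m ^ j * elem_sym (Suc (d + r)) (insert m S)) g = 0"
          by (simp add: poly_diff_mult)
        then have "poly_diff (Var m ^ Suc j * elem_sym (d + r) S) g = 0"
          using Suc.prems fin by (simp add: elem_sym_insert distrib_left poly_diff_add_left mult_ac)
        from Suc.IH[OF this] show ?case by simp
      qed simp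
      \<comment> \<open>Passing from \<open>tail\<close> at c - 1 to \<open>tail\<close> at c costs
        the number of parts of size at least c. These all exceed \<alpha>_p, so i trades suffice,
        and the resulting factor x_m^i is the one in \<open>?h\<close>.\<close>
      have "card {q. q < length \<alpha> \<and> c \<le> \<alpha> ! q} \<le> i"
        by (rule order.trans[OF card_mono i]) (use False in auto)
      then have "card S < d + i + tail \<alpha> (card (X - S))"
        using d False tail_decrement[OF c p] tail_pred[OF c, of \<alpha>] by (simp add: c1 flip: c_def)
      then have "poly_diff (elem_sym (d + i) S) g = 0" using SX gen by blast
      then have "poly_diff (Var m ^ (0 + i) * elem_sym d S) g = 0"
        by (intro red) simp
      then show ?thesis by (simp add: mult.commute flip: poly_diff_mult)
    qed
  qed
  ultimately show ?thesis by (auto simp: harmonic_on_def)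
qed

lemma harmonic_on_poly_diff:
  assumes "g \<in> harmonic_on X \<alpha>"
  shows "poly_diff f g \<in> harmonic_on X \<alpha>"
proof -
  have "poly_diff e (poly_diff f g) = 0" if "poly_diff e g = 0" for e
    using that by (simp add: poly_diff_commute[of e])
  then show ?thesis using assms by (auto simp: harmonic_on_def polys_on_poly_diff)
qed

section \<open>Orthogonality to the ideal\<close>

text \<open>Double counting of boxes; parts of size at most n ensure that the upper limit n cuts off
  no row.\<close>

lemma tail_eq_sum_conjugate:
  assumes "\<And>p. p < length lam \<Longrightarrow> lam ! p \<le> n" "c \<le> n"
  shows "(\<Sum>j\<in>{c + 1..n}. conjugate lam j) = tail lam c"
proof -
  have "(\<Sum>j\<in>{c + 1..n}. conjugate lam j) = (\<Sum>j\<in>{c + 1..n}. \<Sum>p<length lam. if j \<le> lam ! p then 1 else 0)"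
    by (rule sum.cong[OF refl], simp add: conjugate_def sum.If_cases)
       (rule arg_cong[where f = card], auto)
  also have "\<dots> = (\<Sum>p<length lam. \<Sum>j\<in>{c + 1..n}. if j \<le> lam ! p then 1 else 0)"
    by (rule sum.swap)
  also have "\<dots> = tail lam c"
    unfolding tail_def
  proof (rule sum.cong[OF refl])
    fix p assume "p \<in> {..<length lam}"
    then have "{c + 1..n} \<inter> {j. j \<le> lam ! p} = {c + 1..lam ! p}" using assms(1)[of p] by auto
    then show "(\<Sum>j\<in>{c + 1..n}. if j \<le> lam ! p then 1 else 0) = lam ! p - c"
      by (simp add: sum.If_cases)
  qed
  finally show ?thesis .
qed

section \<open>The ring in n variables and the ideal I\<close>

lemma Var_in_polys: "i \<in> {1..n} \<Longrightarrow> Var i \<in> polys n"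
  by (simp add: polys_def Var_def)

lemma polys_power: "p \<in> polys n \<Longrightarrow> p ^ e \<in> polys n"
  by (induction e) (simp_all add: polys_closed)

lemma polys_sum: "(\<And>a. a \<in> A \<Longrightarrow> f a \<in> polys n) \<Longrightarrow> sum f A \<in> polys n"
  by (induction A rule: infinite_finite_induct) (simp_all add: polys_closed)

lemma polys_prod: "(\<And>a. a \<in> A \<Longrightarrow> f a \<in> polys n) \<Longrightarrow> prod f A \<in> polys n"
  by (induction A rule: infinite_finite_induct) (simp_all add: polys_closed)

lemma ideal_gens_in_polys: "ideal_gens n lam \<subseteq> polys n"
proof -
  have "elem_sym d S \<in> polys n" if "S \<subseteq> {1..n}" for d S
    unfolding elem_sym_def using that
    by (intro polys_sum polys_prod Var_in_polys) auto
  then show ?thesis by (auto simp: ideal_gens_def intro!: polys_power Var_in_polys)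
qed

lemma carrier_poly_ring [simp]: "carrier (poly_ring n) = polys n"
  and mult_poly_ring [simp]: "f \<otimes>\<^bsub>poly_ring n\<^esub> g = f * g"
  and add_poly_ring [simp]: "f \<oplus>\<^bsub>poly_ring n\<^esub> g = f + g"
  and zero_poly_ring [simp]: "\<zero>\<^bsub>poly_ring n\<^esub> = 0"
  and one_poly_ring [simp]: "\<one>\<^bsub>poly_ring n\<^esub> = 1"
  by (simp_all add: poly_ring_def)

lemma ring_poly_ring: "ring (poly_ring n)"
  using cring_poly_ring by (rule cring.axioms)

lemma ideal_I_ideal: "ideal (I_ideal n lam) (poly_ring n)"
  unfolding I_ideal_def
  by (rule ring.genideal_ideal[OF ring_poly_ring]) (simp add: ideal_gens_in_polys)

lemma ideal_gens_subset: "ideal_gens n lam \<subseteq> I_ideal n lam"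
  unfolding I_ideal_def
  by (rule ring.genideal_self[OF ring_poly_ring]) (simp add: ideal_gens_in_polys)

lemma I_ideal_subset: "I_ideal n lam \<subseteq> polys n"
  using ideal_I_ideal[of n lam] by (metis additive_subgroup.a_subset carrier_poly_ring ideal.axioms(1))

lemma I_ideal_0: "0 \<in> I_ideal n lam"
  using additive_subgroup.zero_closed[OF ideal.axioms(1)[OF ideal_I_ideal]] by simp

lemma I_ideal_add: "f \<in> I_ideal n lam \<Longrightarrow> g \<in> I_ideal n lam \<Longrightarrow> f + g \<in> I_ideal n lam"
  using additive_subgroup.a_closed[OF ideal.axioms(1)[OF ideal_I_ideal]] by fastforce

lemma I_ideal_mult: "f \<in> polys n \<Longrightarrow> g \<in> I_ideal n lam \<Longrightarrow> f * g \<in> I_ideal n lam"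
  using ideal.I_l_closed[OF ideal_I_ideal] by fastforce

lemma Const_in_polys: "Const c \<in> polys n"
  by (auto simp: polys_def Const_def)

lemma I_ideal_scale: "f \<in> I_ideal n lam \<Longrightarrow> scale c f \<in> I_ideal n lam"
  unfolding scale_def by (intro I_ideal_mult Const_in_polys)

text \<open>Makes minimality of the generated ideal applicable: whatever the generators annihilate
  is annihilated by all of I.\<close>

lemma annihilator_ideal: "ideal {f \<in> polys n. poly_diff f g = 0} (poly_ring n)"
proof (rule idealI[OF ring_poly_ring])
  show "subgroup {f \<in> polys n. poly_diff f g = 0} (add_monoid (poly_ring n))"
  proof (rule group.subgroupI)
    show "Group.group (add_monoid (poly_ring n))"
      by (rule abelian_group.a_group[OF ring.is_abelian_group[OF ring_poly_ring]])
    show "inv\<^bsub>add_monoid (poly_ring n)\<^esub> a \<in> {f \<in> polys n. poly_diff f g = 0}"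
      if a: "a \<in> {f \<in> polys n. poly_diff f g = 0}" for a
    proof -
      have "inv\<^bsub>add_monoid (poly_ring n)\<^esub> a = - a"
        using a \<open>Group.group (add_monoid (poly_ring n))\<close>
        by (intro group.inv_equality) (auto simp: polys_closed)
      then show ?thesis using a by (simp add: polys_closed poly_diff_uminus_left)
    qed
  qed (auto simp: polys_closed poly_diff_add_left intro!: exI[of _ 0])
  show "x \<otimes>\<^bsub>poly_ring n\<^esub> a \<in> {f \<in> polys n. poly_diff f g = 0}"
    "a \<otimes>\<^bsub>poly_ring n\<^esub> x \<in> {f \<in> polys n. poly_diff f g = 0}"
    if "a \<in> {f \<in> polys n. poly_diff f g = 0}" "x \<in> carrier (poly_ring n)" for a x
    using that poly_diff_commute[of a x g] by (auto simp: polys_closed poly_diff_mult)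
qed

lemma I_ideal_annihilates:
  assumes "\<And>f. f \<in> ideal_gens n lam \<Longrightarrow> poly_diff f g = 0" "f \<in> I_ideal n lam"
  shows "poly_diff f g = 0"
proof -
  have "I_ideal n lam \<subseteq> {f \<in> polys n. poly_diff f g = 0}"
    unfolding I_ideal_def
    by (rule ring.genideal_minimal[OF ring_poly_ring annihilator_ideal])
       (use assms(1) ideal_gens_in_polys in auto)
  with assms(2) show ?thesis by auto
qed

lemma harmonic_space_iff_gens:
  "g \<in> harmonic_space n lam \<longleftrightarrow> g \<in> polys n \<and> (\<forall>f\<in>ideal_gens n lam. poly_diff f g = 0)"
proof safe
  assume g: "g \<in> harmonic_space n lam"
  then show gp: "g \<in> polys n" by (simp add: harmonic_space_def)
  fix f assume f: "f \<in> ideal_gens n lam"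
  show "poly_diff f g = 0"
  proof (rule dcoef_eqI)
    fix m
    show "dcoef (poly_diff f g) m = dcoef 0 m"
    proof (cases "keys m \<subseteq> {1..n}")
      case True
      then have "single m 1 \<in> polys n" by (simp add: polys_def)
      then have "single m 1 * f \<in> I_ideal n lam"
        using f ideal_gens_subset by (blast intro: I_ideal_mult)
      then show ?thesis using g by (simp add: dcoef_poly_diff_eq_pairing harmonic_space_def)
    next
      \<comment> \<open>Here x^m lies outside the ring, so orthogonality to I gives nothing; but
        derivatives of g involve only x_1, ..., x_n.\<close>
      case False
      have "poly_diff f g \<in> polys n" using gp by (simp add: polys_eq_polys_on polys_on_poly_diff)
      with False show ?thesis by (auto simp: polys_def)
    qed
  qed
next
  assume "g \<in> polys n" "\<forall>f\<in>ideal_gens n lam. poly_diff f g = 0"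
  then show "g \<in> harmonic_space n lam"
    using I_ideal_annihilates[of n lam g] by (simp add: harmonic_space_def pairing_eq_dcoef)
qed

lemma harmonic_space_eq_harmonic_on:
  assumes "\<And>p. p < length lam \<Longrightarrow> lam ! p \<le> n"
  shows "harmonic_space n lam = harmonic_on {1..n} lam"
proof -
  have *: "(\<Sum>j\<in>{n - card S + 1..n}. conjugate lam j) = tail lam (card ({1..n} - S))"
    if "S \<subseteq> {1..n}" for S
  proof -
    have "card ({1..n} - S) = n - card S"
      using that by (subst card_Diff_subset) (auto dest: finite_subset)
    then show ?thesis using tail_eq_sum_conjugate[OF assms, of "n - card S"] by simp
  qed
  have gens: "ideal_gens n lam = {Var i ^ length lam | i. i \<in> {1..n}} \<union>
      {elem_sym d S | d S. S \<subseteq> {1..n} \<and> card S < d + tail lam (card ({1..n} - S))}"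
    unfolding ideal_gens_def using * by (metis (no_types, lifting))
  show ?thesis
    unfolding set_eq_iff harmonic_on_def harmonic_space_iff_gens gens polys_eq_polys_on by blast
qed

section \<open>The decomposition into ideal and harmonic space\<close>

text \<open>One Gram-Schmidt step: b is replaced by its component \<open>b'\<close> orthogonal to B,
  so a correction along \<open>b'\<close> preserves orthogonality to B. No normalization is made,
  hence no square roots.\<close>

lemma orthogonal_projection:
  assumes "finite B"
  shows "\<exists>u\<in>mpoly_vs.span B. \<forall>b\<in>B. pairing (f - u) b = 0"
  using assms
proof (induction B arbitrary: f rule: finite_induct)
  case empty
  then show ?case by (auto simp: mpoly_vs.span_zero)
next
  case (insert b B)
  have sub: "mpoly_vs.span B \<subseteq> mpoly_vs.span (insert b B)"
    by (rule mpoly_vs.span_mono) auto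
  obtain v where v: "v \<in> mpoly_vs.span B" "\<forall>c\<in>B. pairing (f - v) c = 0"
    using insert.IH by blast
  obtain w where w: "w \<in> mpoly_vs.span B" "\<forall>c\<in>B. pairing (b - w) c = 0"
    using insert.IH by blast
  define b' where "b' = b - w"
  \<comment> \<open>If \<open>b'\<close> is 0, the quotient is a division by zero, harmless because
    it multiplies 0.\<close>
  define u where "u = v + scale (pairing (f - v) b' / pairing b' b') b'"
  have u: "f - u = (f - v) - scale (pairing (f - v) b' / pairing b' b') b'"
    by (simp add: u_def)
  have orth: "pairing (f - u) c = 0" if "c \<in> B" for c
  proof -
    have "pairing b' c = 0" using that w(2) by (simp add: b'_def)
    then show ?thesis using that v(2) by (simp add: u pairing_diff_left pairing_scale_left)
  qed
  have "pairing (f - u) b' = 0"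
    using pairing_self_eq_0[of b']
    by (cases "b' = 0") (auto simp: u pairing_diff_left pairing_scale_left)
  moreover have "pairing (f - u) x = 0" if "x \<in> mpoly_vs.span B" for x
    using that
    by (induction rule: mpoly_vs.span_induct_alt)
       (simp_all add: pairing_add_right pairing_scale_right orth)
  then have "pairing (f - u) w = 0" using w(1) by blast
  ultimately have "pairing (f - u) b = 0" by (simp add: b'_def pairing_diff_right)
  moreover have "u \<in> mpoly_vs.span (insert b B)"
    unfolding u_def b'_def using v(1) w(1) sub
    by (intro mpoly_vs.span_add mpoly_vs.span_scale mpoly_vs.span_diff)
       (auto intro: mpoly_vs.span_base)
  ultimately show ?case using orth by blast
qed

lemma I_ideal_high_exponent:
  assumes "keys m \<subseteq> {1..n}" "i \<in> {1..n}" "length lam \<le> lookup m i"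
  shows "single m c \<in> I_ideal n lam"
proof -
  define m' where "m' = m - single i (length lam)"
  have m: "m = m' + single i (length lam)"
    unfolding m'_def using assms(3)
    by (intro poly_mapping_eqI) (auto simp: lookup_add lookup_minus lookup_single when_def)
  then have "single m c = single m' c * Var i ^ length lam"
    by (simp add: Var_power mult_single)
  moreover have "single m' c \<in> polys n"
    using assms(1) m by (auto simp: polys_def keys_add_nat split: if_splits)
  moreover have "Var i ^ length lam \<in> I_ideal n lam"
    using ideal_gens_subset assms(2) by (auto simp: ideal_gens_def)
  ultimately show ?thesis by (simp add: I_ideal_mult)
qed

lemma finite_bounded_monoms:
  fixes X :: "nat set"
  assumes "finite X"
  shows "finite {m :: monom. keys m \<subseteq> X \<and> (\<forall>i. lookup m i < s)}" (is "finite ?M")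
proof -
  have "(\<Sum>i\<in>X. single i (lookup m i)) = m" if "keys m \<subseteq> X" for m :: monom
    using that assms
    by (intro poly_mapping_eqI) (auto simp: lookup_sum lookup_single when_def in_keys_iff)
  then have "?M \<subseteq> (\<lambda>f. \<Sum>i\<in>X. single i (f i)) ` (X \<rightarrow>\<^sub>E {..<s})"
    by (auto intro!: image_eqI[where x = "restrict (lookup _) X"])
  then show ?thesis
    by (rule finite_subset) (use assms in \<open>auto intro: finite_PiE\<close>)
qed

text \<open>
  All but finitely many monomials lie in the ideal, so it suffices to project orthogonally onto
  the finite-dimensional space of ideal elements with exponents below \<open>s\<close>.
\<close>

lemma ideal_plus_harmonic:
  assumes f: "f \<in> polys n" and s: "0 < length lam"
  shows "\<exists>u\<in>I_ideal n lam. f - u \<in> harmonic_space n lam"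
proof -
  define M where "M = {m :: monom. keys m \<subseteq> {1..n} \<and> (\<forall>i. lookup m i < length lam)}"
  define Q where "Q = {p :: mpoly. keys p \<subseteq> M}"
  define lo where "lo p = (\<Sum>m\<in>keys p \<inter> M. single m (lookup p m))" for p :: mpoly
  define hi where "hi p = (\<Sum>m\<in>keys p - M. single m (lookup p m))" for p :: mpoly
  have finM: "finite M" unfolding M_def by (rule finite_bounded_monoms) simp
  have split: "p = lo p + hi p" for p
    unfolding lo_def hi_def
    by (subst mpoly_eq_sum_single[of p], subst sum.Int_Diff[where B = M]) auto
  have lo_eq: "lo p = p - hi p" for p by (simp add: eq_diff_eq flip: split)
  have lookup_lo: "lookup (lo p) m = (if m \<in> M then lookup p m else 0)" for p m
    by (auto simp: lo_def lookup_sum lookup_single when_def in_keys_iff)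
  then have loQ: "lo p \<in> Q" for p
    by (auto simp: Q_def in_keys_iff split: if_splits)
  have hiI: "hi p \<in> I_ideal n lam" if "p \<in> polys n" for p
  proof -
    have "single m (lookup p m) \<in> I_ideal n lam" if m: "m \<in> keys p" "m \<notin> M" for m
    proof -
      have k: "keys m \<subseteq> {1..n}" using m(1) \<open>p \<in> polys n\<close> by (auto simp: polys_def)
      have "\<not> (\<forall>i. lookup m i < length lam)" using k m(2) by (simp add: M_def)
      then obtain i where i: "length lam \<le> lookup m i" by (metis not_less)
      then have "0 < lookup m i" by (rule less_le_trans[OF s])
      then have "i \<in> keys m" by (simp add: in_keys_iff)
      then show ?thesis by (intro I_ideal_high_exponent[OF k _ i]) (use k in blast)
    qed
    moreover have "sum h A \<in> I_ideal n lam" if "\<And>m. m \<in> A \<Longrightarrow> h m \<in> I_ideal n lam"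
      for A :: "monom set" and h
      using that by (induction A rule: infinite_finite_induct) (auto intro: I_ideal_add I_ideal_0)
    ultimately show ?thesis unfolding hi_def by (metis (no_types, lifting) DiffD1 DiffD2)
  qed
  obtain B where B: "B \<subseteq> I_ideal n lam \<inter> Q" "mpoly_vs.independent B"
      "I_ideal n lam \<inter> Q \<subseteq> mpoly_vs.span B"
    using mpoly_vs.maximal_independent_subset by blast
  have "Q \<subseteq> mpoly_vs.span ((\<lambda>m. single m 1) ` M)"
  proof
    fix p assume "p \<in> Q"
    then have "(\<Sum>m\<in>keys p. scale (lookup p m) (single m 1)) \<in> mpoly_vs.span ((\<lambda>m. single m 1) ` M)"
      by (intro mpoly_vs.span_sum mpoly_vs.span_scale mpoly_vs.span_base) (auto simp: Q_def)
    also have "(\<Sum>m\<in>keys p. scale (lookup p m) (single m 1)) = p"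
      by (simp add: scale_def Const_def mult_single flip: mpoly_eq_sum_single)
    finally show "p \<in> mpoly_vs.span ((\<lambda>m. single m 1) ` M)" .
  qed
  then have finB: "finite B"
    using mpoly_vs.independent_span_bound[of "(\<lambda>m. single m 1) ` M" B] finM B by auto
  obtain u where u: "u \<in> mpoly_vs.span B" "\<forall>b\<in>B. pairing (lo f - u) b = 0"
    using orthogonal_projection[OF finB] by blast
  have "mpoly_vs.subspace (I_ideal n lam \<inter> Q)"
  proof (rule mpoly_vs.subspaceI)
    show "x + y \<in> I_ideal n lam \<inter> Q" if "x \<in> I_ideal n lam \<inter> Q" "y \<in> I_ideal n lam \<inter> Q" for x y
      using that Poly_Mapping.keys_add[of x y] by (auto simp: Q_def I_ideal_add)
  qed (auto simp: Q_def I_ideal_0 I_ideal_scale keys_scale)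
  then have uI: "u \<in> I_ideal n lam" "u \<in> Q"
    using u(1) B(1) mpoly_vs.span_minimal by blast+
  have g: "pairing (lo f - u) x = 0" if "x \<in> mpoly_vs.span B" for x
    using that by (induction rule: mpoly_vs.span_induct_alt)
      (use u(2) in \<open>simp_all add: pairing_add_right pairing_scale_right\<close>)
  have gQ: "keys (lo f - u) \<subseteq> M"
    using keys_diff[of "lo f" u] loQ[of f] uI(2) by (auto simp: Q_def)
  have gp: "lo f - u \<in> polys n" using gQ by (auto simp: polys_def M_def)
  \<comment> \<open>For arbitrary x in I, the low part is in I because the high part is, so the
    projection covers it; the high part shares no monomial with \<open>lo f - u\<close>.\<close>
  have "pairing x (lo f - u) = 0" if x: "x \<in> I_ideal n lam" for x
  proof -
    have xp: "x \<in> polys n" using x I_ideal_subset by blast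
    have "lo x \<in> I_ideal n lam"
      unfolding lo_eq using I_ideal_add[OF x I_ideal_scale[OF hiI[OF xp], of "-1"]] by simp
    then have "pairing (lo f - u) (lo x) = 0" using g B(3) loQ[of x] by blast
    moreover have "pairing (lo f - u) (hi x) = 0"
      unfolding pairing_eq_sum
    proof (rule sum.neutral, safe)
      fix a assume "a \<in> keys (lo f - u)"
      then have "a \<in> M" using gQ by blast
      then have "lookup (hi x) a = 0"
        unfolding hi_def lookup_sum by (auto intro!: sum.neutral simp: lookup_single when_def)
      then show "lookup (lo f - u) a * dcoef (hi x) a = 0" by (simp add: dcoef_def)
    qed
    ultimately have "pairing (lo f - u) x = 0"
      by (subst split[of x]) (simp add: pairing_add_right)
    then show ?thesis by (simp add: pairing_commute)
  qed
  then have "lo f - u \<in> harmonic_space n lam" using gp by (simp add: harmonic_space_def)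
  moreover have "lo f - u = f - (u + hi f)" by (simp add: lo_eq)
  moreover have "u + hi f \<in> I_ideal n lam" using uI hiI[OF f] by (simp add: I_ideal_add)
  ultimately show ?thesis by (intro bexI[of _ "u + hi f"]) simp_all
qed

lemma ideal_inter_harmonic:
  "f \<in> I_ideal n lam \<Longrightarrow> f \<in> harmonic_space n lam \<Longrightarrow> f = 0"
  by (rule pairing_self_eq_0) (simp add: harmonic_space_def)

lemma subspace_harmonic_on: "mpoly_vs.subspace (harmonic_on X \<alpha>)"
  by (rule mpoly_vs.subspaceI)
     (simp_all add: harmonic_on_def polys_on_add polys_on_scale poly_diff_add_right poly_diff_scale_right)

section \<open>Codes of ordered set partitions\<close>

definition OP_on :: "nat set \<Rightarrow> nat list \<Rightarrow> nat set list set" where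
  "OP_on X \<alpha> = {\<sigma>. length \<sigma> = length \<alpha> \<and> (\<Union>p < length \<sigma>. \<sigma> ! p) = X \<and>
     (\<forall>p < length \<sigma>. \<forall>q < length \<sigma>. p \<noteq> q \<longrightarrow> \<sigma> ! p \<inter> \<sigma> ! q = {}) \<and>
     (\<forall>p < length \<sigma>. \<alpha> ! p \<le> card (\<sigma> ! p))}"

definition code_on :: "nat list \<Rightarrow> nat set list \<Rightarrow> nat \<Rightarrow> nat" where
  "code_on \<alpha> \<sigma> i = card {j. coinversion \<alpha> \<sigma> i j} +
     (if floating \<alpha> \<sigma> i then THE p. floating_in \<alpha> \<sigma> p i else 0)"

definition box :: "nat list \<Rightarrow> nat set list \<Rightarrow> nat \<Rightarrow> nat \<Rightarrow> nat" where
  "box \<alpha> \<sigma> p r = sorted_list_of_set (\<sigma> ! p) ! (\<alpha> ! p - r)"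

lemma OP_eq_OP_on: "OP n lam = OP_on {1..n} lam"
  by (simp add: OP_def OP_on_def)

lemma in_box_iff:
  "in_box \<alpha> \<sigma> p r x \<longleftrightarrow> p < length \<alpha> \<and> 1 \<le> r \<and> r \<le> \<alpha> ! p \<and> x = box \<alpha> \<sigma> p r"
  by (simp add: in_box_def box_def)

lemma OP_on_length: "\<sigma> \<in> OP_on X \<alpha> \<Longrightarrow> length \<sigma> = length \<alpha>"
  and OP_on_block_subset: "\<sigma> \<in> OP_on X \<alpha> \<Longrightarrow> p < length \<alpha> \<Longrightarrow> \<sigma> ! p \<subseteq> X"
  and OP_on_card: "\<sigma> \<in> OP_on X \<alpha> \<Longrightarrow> p < length \<alpha> \<Longrightarrow> \<alpha> ! p \<le> card (\<sigma> ! p)"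
  by (auto simp: OP_on_def)

lemma OP_on_disjoint:
  "\<sigma> \<in> OP_on X \<alpha> \<Longrightarrow> p < length \<alpha> \<Longrightarrow> q < length \<alpha> \<Longrightarrow> x \<in> \<sigma> ! p \<Longrightarrow> x \<in> \<sigma> ! q \<Longrightarrow> p = q"
proof (rule ccontr)
  assume *: "\<sigma> \<in> OP_on X \<alpha>" "p < length \<alpha>" "q < length \<alpha>" "x \<in> \<sigma> ! p" "x \<in> \<sigma> ! q" "p \<noteq> q"
  then have "\<sigma> ! p \<inter> \<sigma> ! q = {}" by (simp add: OP_on_def)
  with * show False by blast
qed

lemma OP_on_block:
  assumes "\<sigma> \<in> OP_on X \<alpha>" "x \<in> X"
  obtains p where "p < length \<alpha>" "x \<in> \<sigma> ! p"
  using assms unfolding OP_on_def by auto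

lemma OP_on_finite_block:
  "finite X \<Longrightarrow> \<sigma> \<in> OP_on X \<alpha> \<Longrightarrow> p < length \<alpha> \<Longrightarrow> finite (\<sigma> ! p)"
  by (rule finite_subset[OF OP_on_block_subset])

lemma box_in_block:
  assumes "finite X" "\<sigma> \<in> OP_on X \<alpha>" "p < length \<alpha>" "1 \<le> r" "r \<le> \<alpha> ! p"
  shows "box \<alpha> \<sigma> p r \<in> \<sigma> ! p"
proof -
  have fin: "finite (\<sigma> ! p)" by (rule OP_on_finite_block[OF assms(1-3)])
  have "\<alpha> ! p - r < length (sorted_list_of_set (\<sigma> ! p))"
    using OP_on_card[OF assms(2,3)] assms(4,5) by simp
  from nth_mem[OF this] show ?thesis unfolding box_def using fin by simp
qed

lemma box_less:
  assumes "finite X" "\<sigma> \<in> OP_on X \<alpha>" "p < length \<alpha>" "1 \<le> r" "r < t" "t \<le> \<alpha> ! p"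
  shows "box \<alpha> \<sigma> p t < box \<alpha> \<sigma> p r"
  unfolding box_def
  by (rule sorted_wrt_nth_less[OF strict_sorted_list_of_set])
     (use OP_on_card[OF assms(2,3)] assms in auto)

lemma in_box_in_block:
  "finite X \<Longrightarrow> \<sigma> \<in> OP_on X \<alpha> \<Longrightarrow> in_box \<alpha> \<sigma> p r x \<Longrightarrow> x \<in> \<sigma> ! p"
  using box_in_block by (auto simp: in_box_iff)

lemma in_box_unique:
  assumes "finite X" "\<sigma> \<in> OP_on X \<alpha>" "in_box \<alpha> \<sigma> p r x" "in_box \<alpha> \<sigma> q t x"
  shows "p = q \<and> r = t"
proof -
  have pq: "p = q"
  proof (rule OP_on_disjoint[OF assms(2)])
    show "x \<in> \<sigma> ! p" "x \<in> \<sigma> ! q" using assms(3,4) by (auto intro: in_box_in_block[OF assms(1,2)])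
  qed (use assms(3,4) in \<open>auto simp: in_box_iff\<close>)
  have "\<not> r < t" "\<not> t < r"
    using assms(3,4) box_less[OF assms(1,2), of p r t] box_less[OF assms(1,2), of p t r]
    by (auto simp: in_box_iff pq)
  with pq show ?thesis by simp
qed

lemma floating_in_unique:
  "\<sigma> \<in> OP_on X \<alpha> \<Longrightarrow> floating_in \<alpha> \<sigma> p x \<Longrightarrow> floating_in \<alpha> \<sigma> q x \<Longrightarrow> p = q"
  using OP_on_disjoint by (auto simp: floating_in_def)

lemma not_floating_in_box:
  assumes "finite X" "\<sigma> \<in> OP_on X \<alpha>" "in_box \<alpha> \<sigma> p r x"
  shows "\<not> floating_in \<alpha> \<sigma> q x"
proof
  assume "floating_in \<alpha> \<sigma> q x"
  then have "q = p"
    using assms OP_on_disjoint[OF assms(2)] in_box_in_block[OF assms]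
    by (auto simp: floating_in_def in_box_iff)
  with \<open>floating_in \<alpha> \<sigma> q x\<close> assms(3) show False by (auto simp: floating_in_def)
qed

text \<open>Entries of different columns lie in disjoint blocks. The row \<rho> may depend on the
  column because coinversions look at row r on the right and at row r + 1 on the left.\<close>

lemma inj_on_box:
  assumes "finite X" "\<sigma> \<in> OP_on X \<alpha>"
  shows "inj_on (\<lambda>q. box \<alpha> \<sigma> q (\<rho> q)) {q. q < length \<alpha> \<and> 1 \<le> \<rho> q \<and> \<rho> q \<le> \<alpha> ! q}"
proof (rule inj_onI, clarify)
  fix p q assume *: "p < length \<alpha>" "1 \<le> \<rho> p" "\<rho> p \<le> \<alpha> ! p" "q < length \<alpha>" "1 \<le> \<rho> q" "\<rho> q \<le> \<alpha> ! q"
    and eq: "box \<alpha> \<sigma> p (\<rho> p) = box \<alpha> \<sigma> q (\<rho> q)"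
  have "box \<alpha> \<sigma> p (\<rho> p) \<in> \<sigma> ! p" "box \<alpha> \<sigma> q (\<rho> q) \<in> \<sigma> ! q"
    using * by (simp_all add: box_in_block[OF assms])
  then show "p = q" using OP_on_disjoint[OF assms(2) *(1,4)] by (simp add: eq)
qed

text \<open>Reduces counting entries to counting columns that are long enough.\<close>

lemma card_boxes:
  assumes "finite X" "\<sigma> \<in> OP_on X \<alpha>"
  shows "card {x. \<exists>q. P q \<and> in_box \<alpha> \<sigma> q (\<rho> q) x} =
    card {q. P q \<and> q < length \<alpha> \<and> 1 \<le> \<rho> q \<and> \<rho> q \<le> \<alpha> ! q}"
proof -
  have "{x. \<exists>q. P q \<and> in_box \<alpha> \<sigma> q (\<rho> q) x} =
      (\<lambda>q. box \<alpha> \<sigma> q (\<rho> q)) ` {q. P q \<and> q < length \<alpha> \<and> 1 \<le> \<rho> q \<and> \<rho> q \<le> \<alpha> ! q}"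
    by (auto simp: in_box_iff)
  moreover have "inj_on (\<lambda>q. box \<alpha> \<sigma> q (\<rho> q)) {q. P q \<and> q < length \<alpha> \<and> 1 \<le> \<rho> q \<and> \<rho> q \<le> \<alpha> ! q}"
    by (rule inj_on_subset[OF inj_on_box[OF assms]]) auto
  ultimately show ?thesis by (simp add: card_image)
qed

lemma coinversion_in:
  assumes "finite X" "\<sigma> \<in> OP_on X \<alpha>" "coinversion \<alpha> \<sigma> i j"
  shows "j \<in> X"
  using assms in_box_in_block[OF assms(1,2)] OP_on_block_subset[OF assms(2)]
  unfolding coinversion_def in_box_iff by blast

lemma code_eq_code_on:
  assumes "\<sigma> \<in> OP n lam"
  shows "code n lam \<sigma> i = code_on lam \<sigma> i"
proof -
  have "{j \<in> {1..n}. coinversion lam \<sigma> i j} = {j. coinversion lam \<sigma> i j}"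
    using coinversion_in[of "{1..n}" \<sigma> lam i] assms unfolding OP_eq_OP_on by blast
  then show ?thesis by (simp add: code_def code_on_def)
qed

subsection \<open>Removing the smallest element\<close>

text \<open>
  The smallest element \<open>m\<close>, if it lies in block \<open>p\<close>, is the lowest boxed element of that block,
  and its code is the position of \<open>p\<close> in the following total order of the blocks. Hence the code
  of \<open>m\<close> determines \<open>p\<close>, and the other codes are those of the ordered set partition without \<open>m\<close>.
\<close>

definition outranks :: "nat list \<Rightarrow> nat \<Rightarrow> nat \<Rightarrow> bool" where
  "outranks \<alpha> q p \<longleftrightarrow> \<alpha> ! p < \<alpha> ! q \<or> \<alpha> ! p = \<alpha> ! q \<and> (if \<alpha> ! p = 0 then q < p else p < q)"

definition rank :: "nat list \<Rightarrow> nat \<Rightarrow> nat" where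
  "rank \<alpha> p = card {q. q < length \<alpha> \<and> outranks \<alpha> q p}"

lemma rank_less:
  assumes "p < length \<alpha>"
  shows "rank \<alpha> p < length \<alpha>"
proof -
  have "\<not> outranks \<alpha> p p" by (simp add: outranks_def)
  then have "{q. q < length \<alpha> \<and> outranks \<alpha> q p} \<subseteq> {..<length \<alpha>} - {p}" by blast
  then have "rank \<alpha> p \<le> card ({..<length \<alpha>} - {p})"
    unfolding rank_def by (intro card_mono) simp_all
  then show ?thesis using assms by simp
qed

lemma rank_strict_mono:
  assumes "q < length \<alpha>" "outranks \<alpha> q p"
  shows "rank \<alpha> q < rank \<alpha> p"
  unfolding rank_def
proof (rule psubset_card_mono)
  have tr: "outranks \<alpha> t p" if "outranks \<alpha> t q" for t
    using that assms(2) unfolding outranks_def by (cases "\<alpha> ! p = 0"; cases "\<alpha> ! q = 0") auto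
  have "\<not> outranks \<alpha> q q" by (simp add: outranks_def)
  then have "q \<notin> {t. t < length \<alpha> \<and> outranks \<alpha> t q}" by simp
  moreover have "q \<in> {t. t < length \<alpha> \<and> outranks \<alpha> t p}" using assms by simp
  moreover have "{t. t < length \<alpha> \<and> outranks \<alpha> t q} \<subseteq> {t. t < length \<alpha> \<and> outranks \<alpha> t p}"
    using tr by (intro Collect_mono) simp
  ultimately show "{t. t < length \<alpha> \<and> outranks \<alpha> t q} \<subset> {t. t < length \<alpha> \<and> outranks \<alpha> t p}"
    by (simp only: psubset_eq) metis
qed simp

lemma inj_on_rank: "inj_on (rank \<alpha>) {..<length \<alpha>}"
proof (rule inj_onI)
  fix p q assume *: "p \<in> {..<length \<alpha>}" "q \<in> {..<length \<alpha>}" "rank \<alpha> p = rank \<alpha> q"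
  have "outranks \<alpha> q p \<or> outranks \<alpha> p q" if "p \<noteq> q"
    using that by (auto simp: outranks_def)
  then show "p = q" using * rank_strict_mono[of p \<alpha> q] rank_strict_mono[of q \<alpha> p] by auto
qed

text \<open>An injective self-map of a finite set is onto; this turns an exponent below s into a
  block.\<close>

lemma rank_surj:
  assumes "i < length \<alpha>"
  obtains p where "p < length \<alpha>" "rank \<alpha> p = i"
proof -
  have "rank \<alpha> ` {..<length \<alpha>} = {..<length \<alpha>}"
    by (rule endo_inj_surj) (use inj_on_rank rank_less in auto)
  with assms have "i \<in> rank \<alpha> ` {..<length \<alpha>}" by simp
  with that show ?thesis by auto
qed

definition insert_at :: "nat \<Rightarrow> nat \<Rightarrow> nat set list \<Rightarrow> nat set list" where
  "insert_at m p \<sigma> = \<sigma>[p := insert m (\<sigma> ! p)]"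

text \<open>For \<alpha>_p = 0 the truncated \<alpha>_p - 1 is again 0: then m is floating in its
  block.\<close>

lemma OP_on_insert_at:
  assumes X: "finite X" "m \<notin> X" and p: "p < length \<alpha>" and \<sigma>: "\<sigma> \<in> OP_on X (\<alpha>[p := \<alpha> ! p - 1])"
  shows "insert_at m p \<sigma> \<in> OP_on (insert m X) \<alpha>"
proof -
  have len: "length \<sigma> = length \<alpha>" using OP_on_length[OF \<sigma>] by simp
  have sub: "\<sigma> ! q \<subseteq> X" if "q < length \<alpha>" for q using OP_on_block_subset[OF \<sigma>] that by simp
  have cd: "\<alpha> ! p - 1 \<le> card (\<sigma> ! p)" "q < length \<alpha> \<Longrightarrow> q \<noteq> p \<Longrightarrow> \<alpha> ! q \<le> card (\<sigma> ! q)" for q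
    using OP_on_card[OF \<sigma>, of p] OP_on_card[OF \<sigma>, of q] p by auto
  have fin: "finite (\<sigma> ! p)" using OP_on_finite_block[OF X(1) \<sigma>] p by simp
  have disj: "x \<notin> \<sigma> ! q" if "r < length \<alpha>" "q < length \<alpha>" "r \<noteq> q" "x \<in> \<sigma> ! r" for r q x
    using OP_on_disjoint[OF \<sigma>, of r q x] that by auto
  have un: "(\<Union>q<length \<alpha>. \<sigma> ! q) = X" using \<sigma> len by (simp add: OP_on_def)
  have nth: "insert_at m p \<sigma> ! q = (if q = p then insert m (\<sigma> ! q) else \<sigma> ! q)" if "q < length \<alpha>" for q
    using that len by (simp add: insert_at_def)
  have "(\<Union>q<length \<alpha>. insert_at m p \<sigma> ! q) = insert m X"
    using p by (auto simp: nth un[symmetric] split: if_splits)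
  moreover have "insert_at m p \<sigma> ! q \<inter> insert_at m p \<sigma> ! r = {}"
    if "q < length \<alpha>" "r < length \<alpha>" "q \<noteq> r" for q r
    using that sub[of q] sub[of r] X disj[of q r] disj[of r q] by (auto simp: nth)
  moreover have "\<alpha> ! q \<le> card (insert_at m p \<sigma> ! q)" if "q < length \<alpha>" for q
    using cd that sub[OF p] X fin by (auto simp: nth card_insert_if)
  ultimately show ?thesis using len by (auto simp: OP_on_def insert_at_def)
qed

lemma OP_on_insert_cases:
  assumes X: "finite X" "m \<notin> X" and \<sigma>: "\<sigma> \<in> OP_on (insert m X) \<alpha>"
  obtains p \<tau> where "p < length \<alpha>" "\<tau> \<in> OP_on X (\<alpha>[p := \<alpha> ! p - 1])" "\<sigma> = insert_at m p \<tau>"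
proof -
  obtain p where p: "p < length \<alpha>" "m \<in> \<sigma> ! p" using OP_on_block[OF \<sigma>, of m] by auto
  define \<tau> where "\<tau> = \<sigma>[p := \<sigma> ! p - {m}]"
  have len: "length \<sigma> = length \<alpha>" using OP_on_length[OF \<sigma>] by simp
  have nth: "\<tau> ! q = \<sigma> ! q - {m}" if "q < length \<alpha>" for q
    using that len p OP_on_disjoint[OF \<sigma>, of p q m] by (auto simp: \<tau>_def nth_list_update)
  have un: "(\<Union>q<length \<alpha>. \<sigma> ! q) = insert m X" using \<sigma> len by (simp add: OP_on_def)
  have "(\<Union>q<length \<alpha>. \<tau> ! q) = (\<Union>q<length \<alpha>. \<sigma> ! q) - {m}"
    by (auto simp: nth)
  then have "(\<Union>q<length \<alpha>. \<tau> ! q) = X" using un X(2) by auto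
  moreover have "\<tau> ! q \<inter> \<tau> ! r = {}" if "q < length \<alpha>" "r < length \<alpha>" "q \<noteq> r" for q r
    using that OP_on_disjoint[OF \<sigma>, of q r] by (auto simp: nth)
  moreover have "\<alpha>[p := \<alpha> ! p - 1] ! q \<le> card (\<tau> ! q)" if "q < length \<alpha>" for q
  proof (cases "q = p")
    case True
    have "card (\<sigma> ! p - {m}) = card (\<sigma> ! p) - 1" by (rule card_Diff_singleton[OF p(2)])
    then show ?thesis using OP_on_card[OF \<sigma> p(1)] True p(1) by (simp add: nth)
  next
    case False
    then have "m \<notin> \<sigma> ! q" using OP_on_disjoint[OF \<sigma>, of p q m] p that by auto
    then show ?thesis using OP_on_card[OF \<sigma> that] False that by (simp add: nth)
  qed
  ultimately have "\<tau> \<in> OP_on X (\<alpha>[p := \<alpha> ! p - 1])"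
    using len by (auto simp: OP_on_def \<tau>_def)
  moreover have "\<sigma> = insert_at m p \<tau>"
    using p len by (simp add: insert_at_def \<tau>_def insert_absorb)
  ultimately show ?thesis using that p(1) by blast
qed

lemma sorted_list_of_set_insert_min:
  fixes m :: nat
  assumes "finite A" "\<And>x. x \<in> A \<Longrightarrow> m < x"
  shows "sorted_list_of_set (insert m A) = m # sorted_list_of_set A"
proof -
  have "m \<notin> A" using assms(2) by blast
  moreover have "insort m (sorted_list_of_set A) = m # sorted_list_of_set A"
    using assms by (intro insort_is_Cons) (auto intro: less_imp_le)
  ultimately show ?thesis using assms(1) by simp
qed

text \<open>Putting m in front shifts the sorted block by one position, and the height of the column
  grows by one as well. Old entries therefore keep their rows, and m fills the new bottom
  box.\<close>

lemma in_box_insert_at: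
  assumes X: "finite X" "\<And>x. x \<in> X \<Longrightarrow> m < x" and p: "p < length \<alpha>"
    and \<sigma>: "\<sigma> \<in> OP_on X (\<alpha>[p := \<alpha> ! p - 1])"
  shows "in_box \<alpha> (insert_at m p \<sigma>) q r x \<longleftrightarrow>
    in_box (\<alpha>[p := \<alpha> ! p - 1]) \<sigma> q r x \<or> q = p \<and> r = \<alpha> ! p \<and> 0 < \<alpha> ! p \<and> x = m"
proof (cases "q = p")
  case True
  have len: "length \<sigma> = length \<alpha>" using OP_on_length[OF \<sigma>] by simp
  have "sorted_list_of_set (insert m (\<sigma> ! p)) = m # sorted_list_of_set (\<sigma> ! p)"
    using OP_on_finite_block[OF X(1) \<sigma>] OP_on_block_subset[OF \<sigma>] p X(2)
    by (intro sorted_list_of_set_insert_min) auto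
  then have s: "sorted_list_of_set (insert_at m p \<sigma> ! p) = m # sorted_list_of_set (\<sigma> ! p)"
    using len p by (simp add: insert_at_def)
  show ?thesis
  proof (cases "r < \<alpha> ! p")
    case True
    then have "\<alpha> ! p - r = Suc (\<alpha> ! p - 1 - r)" by simp
    with True \<open>q = p\<close> s p show ?thesis by (auto simp: in_box_def)
  qed (use \<open>q = p\<close> s p in \<open>auto simp: in_box_def\<close>)
next
  case False
  then show ?thesis
    using OP_on_length[OF \<sigma>] by (auto simp: in_box_def insert_at_def)
qed

lemma floating_in_insert_at:
  assumes X: "finite X" "\<And>x. x \<in> X \<Longrightarrow> m < x" and p: "p < length \<alpha>"
    and \<sigma>: "\<sigma> \<in> OP_on X (\<alpha>[p := \<alpha> ! p - 1])" and x: "x \<noteq> m"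
  shows "floating_in \<alpha> (insert_at m p \<sigma>) q x \<longleftrightarrow> floating_in (\<alpha>[p := \<alpha> ! p - 1]) \<sigma> q x"
proof -
  have "x \<in> insert_at m p \<sigma> ! q \<longleftrightarrow> x \<in> \<sigma> ! q" if "q < length \<alpha>"
    using that OP_on_length[OF \<sigma>] x p by (auto simp: insert_at_def nth_list_update)
  then show ?thesis
    using x by (auto simp: floating_in_def in_box_insert_at[OF X p \<sigma>])
qed

text \<open>Codes only look at larger entries and at the position of a floating entry, neither of
  which m affects.\<close>

lemma code_on_insert_at:
  assumes X: "finite X" "\<And>x. x \<in> X \<Longrightarrow> m < x" and p: "p < length \<alpha>"
    and \<sigma>: "\<sigma> \<in> OP_on X (\<alpha>[p := \<alpha> ! p - 1])" and i: "m < i"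
  shows "code_on \<alpha> (insert_at m p \<sigma>) i = code_on (\<alpha>[p := \<alpha> ! p - 1]) \<sigma> i"
proof -
  have bx: "in_box \<alpha> (insert_at m p \<sigma>) q r x \<longleftrightarrow> in_box (\<alpha>[p := \<alpha> ! p - 1]) \<sigma> q r x" if "m < x" for q r x
    using that by (simp add: in_box_insert_at[OF X p \<sigma>])
  have fl: "floating_in \<alpha> (insert_at m p \<sigma>) q x \<longleftrightarrow> floating_in (\<alpha>[p := \<alpha> ! p - 1]) \<sigma> q x" if "m < x" for q x
    using that by (intro floating_in_insert_at[OF X p \<sigma>]) auto
  have "coinversion \<alpha> (insert_at m p \<sigma>) i j \<longleftrightarrow> coinversion (\<alpha>[p := \<alpha> ! p - 1]) \<sigma> i j" for j
  proof (cases "i < j")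
    case True
    then have "m < j" using i by simp
    then show ?thesis by (simp only: coinversion_def bx[OF i] bx[OF \<open>m < j\<close>] fl[OF i])
  qed (simp add: coinversion_def)
  then show ?thesis by (simp add: code_on_def floating_def fl[OF i])
qed

text \<open>Every boxed entry of another block exceeds m, so coinversions of m are counted by
  columns. If \<alpha>_p > 0, then m is in row \<alpha>_p: a column on the right counts if at least
  that long, one on the left only if longer. If \<alpha>_p = 0, nonempty columns on the right count,
  and the summand p stands for all blocks on the left. This is the origin of the ties in
  \<open>outranks\<close>.\<close>

lemma code_on_insert_at_min:
  assumes X: "finite X" "\<And>x. x \<in> X \<Longrightarrow> m < x" and p: "p < length \<alpha>"
    and \<sigma>: "\<sigma> \<in> OP_on X (\<alpha>[p := \<alpha> ! p - 1])"
  shows "code_on \<alpha> (insert_at m p \<sigma>) m = rank \<alpha> p"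
proof -
  let ?\<sigma> = "insert_at m p \<sigma>"
  have mX: "m \<notin> X" using X(2) by blast
  have \<sigma>': "?\<sigma> \<in> OP_on (insert m X) \<alpha>" by (rule OP_on_insert_at[OF X(1) mX p \<sigma>])
  have fin: "finite (insert m X)" using X by simp
  have len: "length \<sigma> = length \<alpha>" using OP_on_length[OF \<sigma>] by simp
  have m: "m \<in> ?\<sigma> ! p" using p len by (simp add: insert_at_def)
  have bx: "in_box \<alpha> ?\<sigma> q r m \<longleftrightarrow> q = p \<and> r = \<alpha> ! p \<and> 0 < \<alpha> ! p" for q r
  proof -
    have "\<not> in_box (\<alpha>[p := \<alpha> ! p - 1]) \<sigma> q r m"
    proof
      assume b: "in_box (\<alpha>[p := \<alpha> ! p - 1]) \<sigma> q r m"
      then have "q < length (\<alpha>[p := \<alpha> ! p - 1])" by (simp add: in_box_iff)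
      from OP_on_block_subset[OF \<sigma> this] in_box_in_block[OF X(1) \<sigma> b] mX show False by blast
    qed
    then show ?thesis by (simp add: in_box_insert_at[OF X p \<sigma>])
  qed
  have fl: "floating_in \<alpha> ?\<sigma> q m \<longleftrightarrow> q = p \<and> \<alpha> ! p = 0" for q
    using m OP_on_disjoint[OF \<sigma>', of p q m] p by (auto simp: floating_in_def bx)
  have gt: "m < j" if "in_box \<alpha> ?\<sigma> q r j" "q \<noteq> p" for q r j
    using in_box_in_block[OF fin \<sigma>' that(1)] that OP_on_block_subset[OF \<sigma>', of q]
      OP_on_disjoint[OF \<sigma>' p, of q m] m X(2)[of j] by (auto simp: in_box_iff)
  show ?thesis
  proof (cases "\<alpha> ! p = 0")
    case True
    have "{j. coinversion \<alpha> ?\<sigma> m j} = {j. \<exists>q. p < q \<and> in_box \<alpha> ?\<sigma> q 1 j}"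
      using gt by (auto simp: coinversion_def bx fl True)
    then have "card {j. coinversion \<alpha> ?\<sigma> m j} = card {q. p < q \<and> q < length \<alpha> \<and> 1 \<le> (1::nat) \<and> 1 \<le> \<alpha> ! q}"
      by (simp only: card_boxes[OF fin \<sigma>', where \<rho> = "\<lambda>_. 1"])
    moreover have "{q. q < length \<alpha> \<and> outranks \<alpha> q p} =
        {q. p < q \<and> q < length \<alpha> \<and> 1 \<le> (1::nat) \<and> 1 \<le> \<alpha> ! q} \<union> {..<p}"
      using p True by (auto simp: outranks_def) (metis less_irrefl linorder_neqE_nat)
    moreover have "card ({q. p < q \<and> q < length \<alpha> \<and> 1 \<le> (1::nat) \<and> 1 \<le> \<alpha> ! q} \<union> {..<p}) =
        card {q. p < q \<and> q < length \<alpha> \<and> 1 \<le> (1::nat) \<and> 1 \<le> \<alpha> ! q} + p"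
      by (subst card_Un_disjoint) auto
    ultimately show ?thesis
      by (simp add: code_on_def rank_def floating_def fl True)
  next
    case False
    have "{j. coinversion \<alpha> ?\<sigma> m j} =
        {j. \<exists>q. q \<noteq> p \<and> in_box \<alpha> ?\<sigma> q (if p < q then \<alpha> ! p else \<alpha> ! p + 1) j}"
    proof -
      have "q \<noteq> p \<and> in_box \<alpha> ?\<sigma> q (if p < q then \<alpha> ! p else \<alpha> ! p + 1) j \<longleftrightarrow>
          p < q \<and> in_box \<alpha> ?\<sigma> q (\<alpha> ! p) j \<or> q < p \<and> in_box \<alpha> ?\<sigma> q (\<alpha> ! p + 1) j" for q j
        by (cases q p rule: linorder_cases) auto
      then show ?thesis
        using gt False by (auto simp: coinversion_def bx fl simp del: add_Suc_right add_0_right Suc_eq_plus1)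
    qed
    then have "card {j. coinversion \<alpha> ?\<sigma> m j} = card {q. q \<noteq> p \<and> q < length \<alpha> \<and>
        1 \<le> (if p < q then \<alpha> ! p else \<alpha> ! p + 1) \<and> (if p < q then \<alpha> ! p else \<alpha> ! p + 1) \<le> \<alpha> ! q}"
      by (simp only: card_boxes[OF fin \<sigma>', where \<rho> = "\<lambda>q. if p < q then \<alpha> ! p else \<alpha> ! p + 1"])
    also have "\<dots> = rank \<alpha> p"
      unfolding rank_def by (rule arg_cong[where f = card]) (use False in \<open>auto simp: outranks_def\<close>)
    finally show ?thesis using False by (simp add: code_on_def floating_def fl)
  qed
qed

lemma code_on_inj:
  assumes "finite X" "\<sigma> \<in> OP_on X \<alpha>" "\<tau> \<in> OP_on X \<alpha>" "\<And>i. i \<in> X \<Longrightarrow> code_on \<alpha> \<sigma> i = code_on \<alpha> \<tau> i"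
  shows "\<sigma> = \<tau>"
  using assms
proof (induction X arbitrary: \<alpha> \<sigma> \<tau> rule: finite_linorder_min_induct)
  case empty
  then show ?case by (auto simp: OP_on_def intro!: nth_equalityI)
next
  case (insert m X)
  then have mX: "m \<notin> X" by blast
  note X = \<open>finite X\<close> insert.hyps(2)[rule_format]
  obtain p \<sigma>' where \<sigma>': "p < length \<alpha>" "\<sigma>' \<in> OP_on X (\<alpha>[p := \<alpha> ! p - 1])" "\<sigma> = insert_at m p \<sigma>'"
    using OP_on_insert_cases[OF X(1) mX insert.prems(1)] by blast
  obtain q \<tau>' where \<tau>': "q < length \<alpha>" "\<tau>' \<in> OP_on X (\<alpha>[q := \<alpha> ! q - 1])" "\<tau> = insert_at m q \<tau>'"
    using OP_on_insert_cases[OF X(1) mX insert.prems(2)] by blast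
  have "rank \<alpha> p = rank \<alpha> q"
    using insert.prems(3)[of m] code_on_insert_at_min[OF X \<sigma>'(1,2)] code_on_insert_at_min[OF X \<tau>'(1,2)]
    by (simp add: \<sigma>' \<tau>')
  then have pq: "p = q" using inj_on_rank[of \<alpha>] \<sigma>' \<tau>' by (auto dest: inj_onD)
  have "\<sigma>' = \<tau>'"
  proof (rule insert.IH[OF \<sigma>'(2)])
    show "\<tau>' \<in> OP_on X (\<alpha>[p := \<alpha> ! p - 1])" using \<tau>' pq by simp
    show "code_on (\<alpha>[p := \<alpha> ! p - 1]) \<sigma>' i = code_on (\<alpha>[p := \<alpha> ! p - 1]) \<tau>' i" if "i \<in> X" for i
      using insert.prems(3)[of i] that code_on_insert_at[OF X \<sigma>'(1,2), of i]
        code_on_insert_at[OF X \<tau>'(1,2), of i] X(2) by (simp add: \<sigma>' \<tau>' pq)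
  qed
  then show ?case by (simp add: \<sigma>' \<tau>' pq)
qed

section \<open>Leading monomials of harmonic polynomials\<close>

text \<open>
  The order on monomials is the lexicographic one with \<open>x\<^sub>1 > x\<^sub>2 > \<dots>\<close>.
\<close>

lemma less_monom_iff:
  "a < b \<longleftrightarrow> (\<exists>k. lookup a k < lookup b k \<and> (\<forall>j<k. lookup a j = lookup b j))" for a b :: monom
  by (simp add: less_poly_mapping.rep_eq less_fun_def)

text \<open>The smallest variable x_m is the largest in the order. So the leading monomial contains
  the top power x_m^i, and the rest of it leads the coefficient of x_m^i, which is \<open>h\<close>
  up to the factor i!.\<close>

lemma leading_monomial_harmonic_on:
  assumes "finite X" "g \<in> harmonic_on X \<alpha>" "g \<noteq> 0"
  shows "\<exists>\<sigma>\<in>OP_on X \<alpha>. \<forall>x\<in>X. lookup (Max (keys g)) x = code_on \<alpha> \<sigma> x"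
  using assms
proof (induction X arbitrary: \<alpha> g rule: finite_linorder_min_induct)
  case empty
  \<comment> \<open>Compositions with boxes but no variables must be excluded: for them e_0 = 1 is
    among the generators and forces g = 0.\<close>
  have "tail \<alpha> 0 = 0"
  proof (rule ccontr)
    assume "tail \<alpha> 0 \<noteq> 0"
    then have "poly_diff (elem_sym 0 {}) g = 0" using empty.prems by (auto simp: harmonic_on_def)
    then have "poly_diff (single 0 1) g = 0" by (simp add: elem_sym_0)
    then have "dcoef g m = 0" for m
      using dcoef_poly_diff_single[of 0 1 g m] by simp
    then have "g = 0" by (intro dcoef_eqI) simp
    with empty.prems show False by simp
  qed
  then have "replicate (length \<alpha>) {} \<in> OP_on {} \<alpha>"
    by (auto simp: OP_on_def tail_def)
  then show ?case by blast
next
  case (insert m X)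
  then have mX: "m \<notin> X" by blast
  note X = \<open>finite X\<close> insert.hyps(2)[rule_format]
  define c where "c = Max (keys g)"
  define i where "i = lookup c m"
  define h where "h = poly_diff (Var m ^ i) g"
  have cg: "c \<in> keys g" unfolding c_def using \<open>g \<noteq> 0\<close> by (intro Max_in) auto
  have cmax: "a \<le> c" if "a \<in> keys g" for a unfolding c_def using that by simp
  have gX: "g \<in> polys_on (insert m X)" using insert.prems by (simp add: harmonic_on_def)
  have dh: "dcoef h a = dcoef g (a + single m i)" for a
    by (simp add: h_def Var_power dcoef_poly_diff_single)
  have sub: "c - single m e + single m e = c" if "e \<le> i" for e
    using that by (intro poly_mapping_eqI) (auto simp: lookup_add lookup_minus lookup_single when_def i_def)
  have "i < length \<alpha>"
  proof (rule ccontr)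
    assume "\<not> i < length \<alpha>"
    have "poly_diff (Var m ^ length \<alpha>) g = 0" using insert.prems by (simp add: harmonic_on_def)
    then have "dcoef g (c - single m (length \<alpha>) + single m (length \<alpha>)) = 0"
      using dcoef_poly_diff_single[of "single m (length \<alpha>)" 1 g] by (simp add: Var_power)
    then show False using sub[of "length \<alpha>"] \<open>\<not> i < length \<alpha>\<close> cg by simp
  qed
  then obtain p where p: "p < length \<alpha>" "rank \<alpha> p = i" by (rule rank_surj)
  \<comment> \<open>A higher power of x_m in g would give a monomial above c, since no variable of g
    precedes x_m.\<close>
  have "poly_diff (Var m) h = 0"
  proof (rule dcoef_eqI)
    fix a
    have "a + single m (Suc i) \<notin> keys g"
    proof
      assume a: "a + single m (Suc i) \<in> keys g"
      have "c < a + single m (Suc i)"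
        unfolding less_monom_iff
      proof (intro exI[of _ m] conjI allI impI)
        fix j assume "j < m"
        then have "j \<notin> insert m X" using X(2) by (auto dest: less_asym)
        then have "j \<notin> keys c" "j \<notin> keys (a + single m (Suc i))"
          using gX cg a by (auto simp: polys_on_def)
        then show "lookup c j = lookup (a + single m (Suc i)) j" by (simp add: in_keys_iff)
      qed (simp add: lookup_add i_def)
      with cmax[OF a] show False by simp
    qed
    then show "dcoef (poly_diff (Var m) h) a = dcoef 0 a"
      by (simp add: Var_def dcoef_poly_diff_single dh add.assoc flip: single_add)
  qed
  \<comment> \<open>Every block with a strictly larger part outranks p; ties can only add to the
    rank.\<close>
  moreover have "card {q. q < length \<alpha> \<and> \<alpha> ! p < \<alpha> ! q} \<le> i"
    unfolding p(2)[symmetric] rank_def by (rule card_mono) (auto simp: outranks_def)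
  ultimately have "h \<in> harmonic_on (insert m X - {m}) (\<alpha>[p := \<alpha> ! p - 1])"
    unfolding h_def using insert.prems p(1) X(1)
    by (intro harmonic_on_top_coefficient) auto
  then have hH: "h \<in> harmonic_on X (\<alpha>[p := \<alpha> ! p - 1])" using mX by simp
  have c': "c - single m i \<in> keys h"
    using cg sub[of i] dcoef_eq_0_iff[of h "c - single m i"] by (simp add: dh)
  then have "h \<noteq> 0" by auto
  have "Max (keys h) = c - single m i"
  proof (rule Max_eqI[OF _ _ c'])
    fix a assume "a \<in> keys h"
    then have "a + single m i \<in> keys g" using dcoef_eq_0_iff[of h a] by (simp add: dh)
    then have "a + single m i \<le> c - single m i + single m i" using cmax sub[of i] by simp
    then show "a \<le> c - single m i" by (simp only: add_le_cancel_right)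
  qed simp
  moreover obtain \<sigma> where \<sigma>: "\<sigma> \<in> OP_on X (\<alpha>[p := \<alpha> ! p - 1])"
      "\<forall>x\<in>X. lookup (Max (keys h)) x = code_on (\<alpha>[p := \<alpha> ! p - 1]) \<sigma> x"
    using insert.IH[OF hH \<open>h \<noteq> 0\<close>] by blast
  ultimately have "lookup c x = code_on \<alpha> (insert_at m p \<sigma>) x" if "x \<in> X" for x
    using that mX code_on_insert_at[OF X p(1) \<sigma>(1), of x] X(2)[of x]
    by (auto simp: lookup_minus lookup_single when_def)
  moreover have "lookup c m = code_on \<alpha> (insert_at m p \<sigma>) m"
    using code_on_insert_at_min[OF X p(1) \<sigma>(1)] p by (simp add: i_def)
  ultimately show ?case
    using OP_on_insert_at[OF X(1) mX p(1) \<sigma>(1)] by (auto simp: c_def)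
qed

section \<open>Codes are bounded by maximal codes\<close>

lemma card_container_row:
  assumes "finite X" "\<sigma> \<in> OP_on X \<alpha>" "1 \<le> r"
  shows "card (container_row \<alpha> \<sigma> r) = conjugate \<alpha> r"
  using card_boxes[OF assms(1,2), of "\<lambda>_. True" "\<lambda>_. r"] assms(3)
  by (simp add: container_row_def conjugate_def)

lemma container_row_subset: "finite X \<Longrightarrow> \<sigma> \<in> OP_on X \<alpha> \<Longrightarrow> container_row \<alpha> \<sigma> r \<subseteq> X"
proof
  fix x assume *: "finite X" "\<sigma> \<in> OP_on X \<alpha>" "x \<in> container_row \<alpha> \<sigma> r"
  then obtain p where p: "in_box \<alpha> \<sigma> p r x" by (auto simp: container_row_def)
  then have "p < length \<alpha>" by (simp add: in_box_iff)
  from OP_on_block_subset[OF *(2) this] in_box_in_block[OF *(1,2) p] show "x \<in> X" by blast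
qed

lemma container_row_disjoint:
  "finite X \<Longrightarrow> \<sigma> \<in> OP_on X \<alpha> \<Longrightarrow> x \<in> container_row \<alpha> \<sigma> r \<Longrightarrow> x \<in> container_row \<alpha> \<sigma> t \<Longrightarrow> r = t"
  using in_box_unique by (fastforce simp: container_row_def)

lemma floating_iff:
  assumes "finite X" "\<sigma> \<in> OP_on X \<alpha>" "x \<in> X"
  shows "floating \<alpha> \<sigma> x \<longleftrightarrow> (\<nexists>r. x \<in> container_row \<alpha> \<sigma> r)"
proof -
  obtain p where p: "p < length \<alpha>" "x \<in> \<sigma> ! p" using OP_on_block[OF assms(2,3)] .
  show ?thesis
  proof
    show "\<nexists>r. x \<in> container_row \<alpha> \<sigma> r" if "floating \<alpha> \<sigma> x"
      using that not_floating_in_box[OF assms(1,2)] by (auto simp: floating_def container_row_def)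
    show "floating \<alpha> \<sigma> x" if "\<nexists>r. x \<in> container_row \<alpha> \<sigma> r"
      using that p by (auto simp: floating_def floating_in_def container_row_def)
  qed
qed

text \<open>The conjugate part is the length of the row, and the m-th smallest entry has m entries
  up to itself. Counting larger entries is the form comparable both with coinversions and with boxes
  below.\<close>

lemma maxcode_container_row:
  assumes "finite X" "\<sigma> \<in> OP_on X \<alpha>" "i \<in> container_row \<alpha> \<sigma> r"
  shows "maxcode \<alpha> \<sigma> i = card {x \<in> container_row \<alpha> \<sigma> r. i < x}"
proof -
  let ?C = "container_row \<alpha> \<sigma> r"
  have i: "i \<in> X" using container_row_subset[OF assms(1,2)] assms(3) by blast
  have "1 \<le> r" using assms(3) by (auto simp: container_row_def in_box_iff)
  have fin: "finite ?C" using container_row_subset[OF assms(1,2)] assms(1) finite_subset by blast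
  have the: "(THE r. i \<in> container_row \<alpha> \<sigma> r) = r"
    using assms(3) container_row_disjoint[OF assms(1,2)] by blast
  have "?C = {x \<in> ?C. x \<le> i} \<union> {x \<in> ?C. i < x}" by auto
  then have "card ?C = card {x \<in> ?C. x \<le> i} + card {x \<in> ?C. i < x}"
    by (subst (1) \<open>?C = _\<close>, subst card_Un_disjoint) (use fin in auto)
  then show ?thesis
    using assms(3) floating_iff[OF assms(1,2) i] card_container_row[OF assms(1,2) \<open>1 \<le> r\<close>]
    by (auto simp: maxcode_def the)
qed

text \<open>A floating entry of block p has at most s - 1 - p coinversions (blocks counted from 0),
  to which p is added. For a boxed entry of row r, a coinversion with row r + 1 on the left is
  replaced by the entry just above it, which is larger still; this injects the coinversions into the
  larger entries of row r.\<close>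

lemma code_le_maxcode:
  assumes X: "finite X" and \<sigma>: "\<sigma> \<in> OP_on X \<alpha>" and i: "i \<in> X"
  shows "code_on \<alpha> \<sigma> i \<le> maxcode \<alpha> \<sigma> i"
proof (cases "floating \<alpha> \<sigma> i")
  case True
  then obtain p where p: "floating_in \<alpha> \<sigma> p i" by (auto simp: floating_def)
  have nb: "\<not> in_box \<alpha> \<sigma> q r i" for q r
    using not_floating_in_box[OF X \<sigma>, of q r i p] p by metis
  have fp: "floating_in \<alpha> \<sigma> q i \<longleftrightarrow> q = p" for q
    using p floating_in_unique[OF \<sigma> p, of q] by metis
  then have "(THE p. floating_in \<alpha> \<sigma> p i) = p" by simp
  moreover have "coinversion \<alpha> \<sigma> i j \<longleftrightarrow> i < j \<and> (\<exists>q. p < q \<and> in_box \<alpha> \<sigma> q 1 j)" for j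
    by (simp add: coinversion_def nb fp)
  then have "{j. coinversion \<alpha> \<sigma> i j} \<subseteq> (\<lambda>q. box \<alpha> \<sigma> q 1) ` {p<..<length \<alpha>}"
    by (auto simp: in_box_iff)
  then have "card {j. coinversion \<alpha> \<sigma> i j} \<le> card {p<..<length \<alpha>}"
    by (rule surj_card_le[rotated]) simp
  moreover have "p < length \<alpha>" using p by (simp add: floating_in_def)
  ultimately show ?thesis using True by (simp add: code_on_def maxcode_def)
next
  case False
  then obtain r p where r: "i \<in> container_row \<alpha> \<sigma> r" and p: "in_box \<alpha> \<sigma> p r i"
    using floating_iff[OF X \<sigma> i] by (auto simp: container_row_def)
  let ?\<rho> = "\<lambda>q. if p < q then r else r + 1"
  define Q where "Q = {q. q \<noteq> p \<and> q < length \<alpha> \<and> ?\<rho> q \<le> \<alpha> ! q \<and> i < box \<alpha> \<sigma> q (?\<rho> q)}"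
  have r1: "1 \<le> r" using p by (simp add: in_box_iff)
  have nf: "\<not> floating_in \<alpha> \<sigma> q i" for q by (rule not_floating_in_box[OF X \<sigma> p])
  have ib: "in_box \<alpha> \<sigma> q t i \<longleftrightarrow> q = p \<and> t = r" for q t
    using p in_box_unique[OF X \<sigma> p, of q t] by metis
  have "{j. coinversion \<alpha> \<sigma> i j} \<subseteq> (\<lambda>q. box \<alpha> \<sigma> q (?\<rho> q)) ` Q"
  proof
    fix j assume j: "j \<in> {j. coinversion \<alpha> \<sigma> i j}"
    then have "i < j" "(\<exists>q. p < q \<and> in_box \<alpha> \<sigma> q r j) \<or> (\<exists>q. q < p \<and> in_box \<alpha> \<sigma> q (r + 1) j)"
      by (simp_all add: coinversion_def nf ib)
    from this(2) show "j \<in> (\<lambda>q. box \<alpha> \<sigma> q (?\<rho> q)) ` Q"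
    proof (elim disjE exE conjE)
      fix q assume "p < q" "in_box \<alpha> \<sigma> q r j"
      then show ?thesis
        using \<open>i < j\<close> by (intro image_eqI[of _ _ q]) (simp_all add: Q_def in_box_iff)
    next
      fix q assume "q < p" "in_box \<alpha> \<sigma> q (r + 1) j"
      then show ?thesis
        using \<open>i < j\<close> by (intro image_eqI[of _ _ q]) (simp_all add: Q_def in_box_iff)
    qed
  qed
  then have "card {j. coinversion \<alpha> \<sigma> i j} \<le> card Q"
    by (rule surj_card_le[rotated]) (simp add: Q_def)
  also have "card Q \<le> card {x \<in> container_row \<alpha> \<sigma> r. i < x}"
  proof (rule card_inj_on_le)
    show "inj_on (\<lambda>q. box \<alpha> \<sigma> q r) Q"
      by (rule inj_on_subset[OF inj_on_box[OF X \<sigma>]]) (use r1 in \<open>auto simp: Q_def split: if_splits\<close>)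
    show "(\<lambda>q. box \<alpha> \<sigma> q r) ` Q \<subseteq> {x \<in> container_row \<alpha> \<sigma> r. i < x}"
    proof clarify
      fix q assume q: "q \<in> Q"
      then have "i < box \<alpha> \<sigma> q r"
        using box_less[OF X \<sigma>, of q r "r + 1"] r1 by (auto simp: Q_def split: if_splits)
      then show "box \<alpha> \<sigma> q r \<in> container_row \<alpha> \<sigma> r \<and> i < box \<alpha> \<sigma> q r"
        using q r1 by (auto simp: Q_def container_row_def in_box_iff split: if_splits)
    qed
    show "finite {x \<in> container_row \<alpha> \<sigma> r. i < x}"
      using container_row_subset[OF X \<sigma>] X finite_subset by fastforce
  qed
  finally show ?thesis
    using False by (simp add: code_on_def maxcode_container_row[OF X \<sigma> r])
qed

section \<open>Permuting exponents\<close>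

abbreviation pinv :: "('a \<Rightarrow> 'b) \<Rightarrow> 'b \<Rightarrow> 'a" where "pinv w \<equiv> inv_into UNIV w"

definition perm_monom :: "(nat \<Rightarrow> nat) \<Rightarrow> monom \<Rightarrow> monom" where
  "perm_monom w m = (\<Sum>i\<in>keys m. single (w i) (lookup m i))"

lemma lookup_perm_monom:
  assumes "bij w"
  shows "lookup (perm_monom w m) j = lookup m (pinv w j)"
proof -
  have "lookup (single (w i) (lookup m i)) j = (if i = pinv w j then lookup m i else 0)" for i
    using assms by (auto simp: lookup_single when_def bij_inv_eq_iff)
  then show ?thesis
    by (simp add: perm_monom_def lookup_sum in_keys_iff)
qed

lemma lookup_perm_monom_image: "bij w \<Longrightarrow> lookup (perm_monom w m) (w i) = lookup m i"
  by (simp add: lookup_perm_monom bij_is_inj)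

lemma perm_monom_eqI:
  assumes "bij w" "\<And>i. lookup a (w i) = lookup m i"
  shows "perm_monom w m = a"
proof (rule poly_mapping_eqI)
  fix j
  have "lookup a (w (pinv w j)) = lookup m (pinv w j)" by (rule assms(2))
  then show "lookup (perm_monom w m) j = lookup a j"
    using assms(1) by (simp add: lookup_perm_monom bij_is_surj surj_f_inv_f)
qed

lemma perm_act_single: "perm_act w (single m 1) = single (perm_monom w m) 1"
  by (simp add: perm_act_def Const_1 perm_monom_def prod_Var_power)

lemma perm_monom_add: "bij w \<Longrightarrow> perm_monom w (a + b) = perm_monom w a + perm_monom w b"
  by (rule poly_mapping_eqI) (simp add: lookup_perm_monom lookup_add)

lemma perm_monom_comp:
  assumes "bij v" "bij w"
  shows "perm_monom (v \<circ> w) m = perm_monom v (perm_monom w m)"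
  by (rule perm_monom_eqI) (use assms in \<open>simp_all add: bij_comp lookup_perm_monom_image\<close>)

lemma mfact_perm_monom:
  assumes "bij w"
  shows "mfact (perm_monom w m) = mfact m"
proof -
  have "keys (perm_monom w m) \<subseteq> w ` keys m"
    using Poly_Mapping.keys_sum[of "\<lambda>i. single (w i) (lookup m i)" "keys m"]
    by (fastforce simp: perm_monom_def split: if_splits)
  then have "mfact (perm_monom w m) = (\<Prod>j\<in>w ` keys m. fact (lookup (perm_monom w m) j))"
    by (intro mfact_superset) auto
  also have "\<dots> = mfact m"
    using assms
    by (subst prod.reindex) (simp_all add: inj_on_subset[OF bij_is_inj] lookup_perm_monom_image mfact_def)
  finally show ?thesis .
qed

definition indicator_monom :: "nat set \<Rightarrow> monom" where
  "indicator_monom M = (\<Sum>i\<in>M. single i 1)"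

lemma lookup_indicator_monom: "finite M \<Longrightarrow> lookup (indicator_monom M) i = (if i \<in> M then 1 else 0)"
  by (simp add: indicator_monom_def lookup_sum lookup_single when_def)

lemma perm_monom_indicator:
  assumes "bij w" "finite M"
  shows "perm_monom w (indicator_monom M) = indicator_monom (w ` M)"
  by (rule perm_monom_eqI)
     (use assms in \<open>simp_all add: lookup_indicator_monom inj_image_mem_iff bij_is_inj\<close>)

lemma dcoef_elem_sym:
  assumes "finite S"
  shows "dcoef (poly_diff (elem_sym d S) g) m =
    (\<Sum>M | M \<subseteq> S \<and> card M = d. dcoef g (m + indicator_monom M))"
proof -
  have "(\<Prod>i\<in>M. Var i) = single (indicator_monom M) 1" if "M \<subseteq> S" for M
    using prod_Var_power[of M "\<lambda>i. i" "\<lambda>_. 1"] finite_subset[OF that assms] by (simp add: indicator_monom_def)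
  then show ?thesis
    by (simp add: elem_sym_def poly_diff_sum_left dcoef_sum dcoef_poly_diff_single)
qed

section \<open>Sums of distinct exponents\<close>

text \<open>In increasing order of i the counts are |C| - 1, ..., 1, 0.\<close>

lemma sum_card_greater:
  fixes C :: "nat set"
  assumes "finite C"
  shows "(\<Sum>i\<in>C. card {x \<in> C. i < x}) = \<Sum>{..<card C}"
  using assms
proof (induction C rule: finite_linorder_min_induct)
  case (insert m C)
  have m: "m \<notin> C" using insert.hyps(2) by blast
  have "{x \<in> insert m C. m < x} = C" using insert.hyps(2) by auto
  moreover have "{x \<in> insert m C. i < x} = {x \<in> C. i < x}" if "i \<in> C" for i
    using that insert.hyps(2) by (auto dest: less_asym)
  ultimately show ?case
    using insert m by (simp add: lessThan_Suc)
qed simp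

text \<open>The largest element is at least the number of the others. With the previous lemma:
  maxcode on a container row has the least sum that distinct exponents allow.\<close>

lemma sum_distinct_ge:
  fixes A :: "nat set"
  assumes "finite A"
  shows "\<Sum>{..<card A} \<le> \<Sum>A"
  using assms
proof (induction A rule: finite_linorder_max_induct)
  case (insert b A)
  have "A \<subseteq> {..<b}" using insert.hyps(2) by auto
  from card_mono[OF _ this] have "card A \<le> b" by simp
  moreover have "b \<notin> A" using insert.hyps(2) by blast
  ultimately show ?case using insert by (simp add: lessThan_Suc)
qed simp

section \<open>The polynomials attached to ordered set partitions\<close>

text \<open>\<open>parts\<close> keeps the truncated \<open>length lam - 1\<close>, the exponent of
  floating entries, below \<open>length lam\<close>.\<close>

locale ordered_set_partition =
  fixes n :: nat and lam :: "nat list" and \<sigma> :: "nat set list"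
  assumes \<sigma>: "\<sigma> \<in> OP_on {1..n} lam"
    and parts: "0 < length lam"
begin

abbreviation "T \<equiv> tableau_of lam \<sigma>"
abbreviation "C \<equiv> container_row lam \<sigma>"
abbreviation "G \<equiv> column_group n T"

section \<open>The exponent vector of x(T)\<close>

definition b :: monom where
  "b = (\<Sum>i\<in>{1..n}. single i (maxcode lam \<sigma> i))"

lemma lookup_b: "lookup b i = (if i \<in> {1..n} then maxcode lam \<sigma> i else 0)"
  by (simp add: b_def lookup_sum lookup_single when_def)

lemma C_subset: "C r \<subseteq> {1..n}"
  by (rule container_row_subset[OF _ \<sigma>]) simp

lemma finite_C [simp]: "finite (C r)"
  using C_subset by (rule finite_subset) simp

lemma set_T [simp]: "set (T r) = C r"
  by (simp add: tableau_of_def)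

lemma C_disjoint: "x \<in> C r \<Longrightarrow> x \<in> C t \<Longrightarrow> r = t"
  by (rule container_row_disjoint[OF _ \<sigma>]) simp_all

lemma entries_T: "entries T = (\<Union>r. C r)"
  by (simp add: entries_def)

lemma card_C: "1 \<le> r \<Longrightarrow> card (C r) = conjugate lam r"
  by (rule card_container_row[OF _ \<sigma>]) simp_all

lemma C_0: "C 0 = {}"
  by (simp add: container_row_def in_box_def)

lemma lookup_b_C: "i \<in> C r \<Longrightarrow> lookup b i = card {x \<in> C r. i < x}"
  using C_subset[of r] maxcode_container_row[OF _ \<sigma>, of i r] by (auto simp: lookup_b)

lemma sum_b_C: "(\<Sum>i\<in>C r. lookup b i) = \<Sum>{..<card (C r)}"
  by (simp add: lookup_b_C sum_card_greater flip: sum_card_greater cong: sum.cong)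

text \<open>Columns of T increase strictly and are disjoint, so i occurs once and exactly the larger
  entries of its column stand below it.\<close>

lemma boxes_below_eq:
  assumes "i \<in> C r"
  shows "boxes_below T i = card {x \<in> C r. i < x}"
proof -
  have T: "T j ! q \<in> C j" if "q < length (T j)" for j q
    using nth_mem[OF that] by simp
  have mono: "T j ! p < T j ! q" if "p < q" "q < length (T j)" for p q j
    using that unfolding tableau_of_def
    by (intro sorted_wrt_nth_less[OF strict_sorted_list_of_set]) auto
  have mono_iff: "T j ! p < T j ! q \<longleftrightarrow> p < q" if "p < length (T j)" "q < length (T j)" for p q j
    using that mono[of p q j] mono[of q p j] by (cases p q rule: linorder_cases) auto
  obtain t where t: "t < length (T r)" "T r ! t = i"
    using assms by (metis in_set_conv_nth set_T)
  have "q < length (T j) \<and> (\<exists>u<q. T j ! u = i) \<longleftrightarrow> j = r \<and> q \<in> {t<..<length (T r)}" for j q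
  proof
    assume "q < length (T j) \<and> (\<exists>u<q. T j ! u = i)"
    then obtain u where u: "q < length (T j)" "u < q" "T j ! u = i" by auto
    then have "i \<in> C j" using T[of u j] by simp
    then have jr: "j = r" using assms C_disjoint by blast
    then have "T r ! t < T r ! q" using u mono[of u q j] t by simp
    then have "t < q" using mono_iff[of t r q] t u jr by simp
    then show "j = r \<and> q \<in> {t<..<length (T r)}" using u jr by simp
  qed (use t in auto)
  then have "{(j, q). q < length (T j) \<and> (\<exists>u<q. T j ! u = i)} = {(j, q). j = r \<and> q \<in> {t<..<length (T r)}}"
    by (simp only:)
  also have "\<dots> = {r} \<times> {t<..<length (T r)}" by auto
  finally have "{(j, q). q < length (T j) \<and> (\<exists>u<q. T j ! u = i)} = {r} \<times> {t<..<length (T r)}" .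
  then have "boxes_below T i = card {t<..<length (T r)}"
    by (simp add: boxes_below_def)
  also have "\<dots> = card ((!) (T r) ` {t<..<length (T r)})"
    by (rule card_image[symmetric], rule inj_on_nth) (auto simp: tableau_of_def)
  also have "(!) (T r) ` {t<..<length (T r)} = {x \<in> C r. i < x}"
  proof (intro equalityI subsetI)
    fix x assume "x \<in> {x \<in> C r. i < x}"
    then obtain q where "q < length (T r)" "x = T r ! q" "i < x"
      by (metis (no_types, lifting) in_set_conv_nth mem_Collect_eq set_T)
    then show "x \<in> (!) (T r) ` {t<..<length (T r)}"
      using mono_iff[of t r q] t by auto
  qed (use T mono t in auto)
  finally show ?thesis .
qed

lemma x_monom_T: "x_monom n (length lam) T = single b 1"
proof -
  have *: "(if i \<in> entries T then boxes_below T i else length lam - 1) = maxcode lam \<sigma> i"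
    if "i \<in> {1..n}" for i
  proof (cases "i \<in> entries T")
    case True
    then obtain r where "i \<in> C r" by (auto simp: entries_T)
    then show ?thesis
      using True boxes_below_eq maxcode_container_row[OF _ \<sigma>] by simp
  next
    case False
    then have "floating lam \<sigma> i"
      using floating_iff[OF _ \<sigma> that] by (auto simp: entries_T)
    then show ?thesis using False by (simp add: maxcode_def)
  qed
  have "x_monom n (length lam) T = (\<Prod>i\<in>{1..n}. Var i ^ maxcode lam \<sigma> i)"
    unfolding x_monom_def by (rule prod.cong[OF refl]) (simp only: *)
  then show ?thesis by (simp add: prod_Var_power b_def)
qed

section \<open>The group preserving each container row\<close>

lemma G_iff: "w \<in> G \<longleftrightarrow> w permutes {1..n} \<and> (\<forall>r. w ` C r = C r) \<and> (\<forall>i. i \<notin> (\<Union>r. C r) \<longrightarrow> w i = i)"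
  by (simp add: column_group_def entries_T)

lemma finite_G: "finite G"
  by (rule finite_subset[OF _ finite_permutations[of "{1..n}"]]) (auto simp: column_group_def)

lemma G_bij: "w \<in> G \<Longrightarrow> bij w"
  by (auto simp: G_iff intro: permutes_bij)

lemma G_comp:
  assumes "v \<in> G" "w \<in> G"
  shows "v \<circ> w \<in> G"
proof -
  have "(v \<circ> w) ` C r = C r" for r
    using assms by (simp only: image_comp[symmetric] G_iff)
  then show ?thesis using assms by (auto simp: G_iff permutes_compose)
qed

lemma G_inv_C: "w \<in> G \<Longrightarrow> i \<in> C r \<Longrightarrow> pinv w i \<in> C r"
  by (metis G_bij G_iff bij_inv_eq_iff imageE)

lemma G_sign: "w \<in> G \<Longrightarrow> permutation w"
  by (auto simp: G_iff intro: permutation_permutes[THEN iffD2])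

lemma transpose_in_G:
  assumes "x \<in> C r" "y \<in> C r"
  shows "transpose x y \<in> G"
proof -
  have "transpose x y ` C t = C t" for t
  proof (cases "t = r")
    case False
    then have "x \<notin> C t" "y \<notin> C t" using assms C_disjoint by blast+
    then show ?thesis by (force simp: transpose_def image_iff)
  next
    case True
    then show ?thesis using assms by (auto simp: transpose_image_eq)
  qed
  moreover have "transpose x y permutes {1..n}"
    using assms by (intro permutes_swap_id subsetD[OF C_subset])
  moreover have "transpose x y i = i" if "i \<notin> (\<Union>r. C r)" for i
    using that assms by (auto simp: transpose_def)
  ultimately show ?thesis by (simp add: G_iff)
qed

section \<open>Leading term and antisymmetry of the signed sum\<close>

abbreviation "\<Delta> \<equiv> delta_tableau n (length lam) T"

lemma lookup_\<Delta>: "lookup \<Delta> m = (\<Sum>w\<in>G. if perm_monom w b = m then of_int (sign w) else 0)"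
  unfolding delta_tableau_def x_monom_T
  by (simp add: lookup_sum lookup_scale perm_act_single lookup_single when_def cong: if_cong)
     (rule sum.cong, auto)

lemma keys_\<Delta>:
  assumes "m \<in> keys \<Delta>"
  obtains w where "w \<in> G" "m = perm_monom w b"
proof -
  have "lookup \<Delta> m \<noteq> 0" using assms by (simp add: in_keys_iff)
  then obtain w where "w \<in> G" "(if perm_monom w b = m then of_int (sign w) else 0 :: rat) \<noteq> 0"
    unfolding lookup_\<Delta> by (blast intro: sum.neutral)
  then show ?thesis using that by (auto split: if_splits)
qed

text \<open>At the least displaced index the exponent of a larger entry of the same container row
  arrives, and \<open>b\<close> decreases strictly along a row.\<close>

lemma perm_monom_b_less:
  assumes w: "w \<in> G" and "w \<noteq> id"
  shows "perm_monom w b < b"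
proof -
  have bij: "bij w" using w by (rule G_bij)
  define v where "v = pinv w"
  have wv: "w (v x) = x" for x
    unfolding v_def using bij by (simp add: bij_is_surj surj_f_inv_f)
  have "v \<noteq> id"
  proof
    assume "v = id"
    then have "w x = x" for x using wv[of x] by simp
    with \<open>w \<noteq> id\<close> show False by (simp add: fun_eq_iff)
  qed
  then have "\<exists>k. v k \<noteq> k" by (auto simp: fun_eq_iff)
  \<comment> \<open>All indices below k are fixed by v, and v is injective, so v k can only lie
    above k.\<close>
  define k where "k = (LEAST k. v k \<noteq> k)"
  have k: "v k \<noteq> k" unfolding k_def using \<open>\<exists>k. v k \<noteq> k\<close> by (rule LeastI_ex)
  have below: "v j = j" if "j < k" for j using that not_less_Least unfolding k_def by blast
  have "inj v" unfolding v_def using bij by (simp add: bij_imp_bij_inv bij_is_inj)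
  have "k < v k"
  proof (rule ccontr)
    assume "\<not> k < v k"
    then have "v (v k) = v k" using k below[of "v k"] by simp
    then show False using \<open>inj v\<close> k by (auto dest: injD)
  qed
  have "w k \<noteq> k" using k inv_f_f[OF bij_is_inj[OF bij], of k] by (auto simp: v_def)
  then obtain r where r: "k \<in> C r" using w unfolding G_iff by blast
  then have vr: "v k \<in> C r" unfolding v_def by (rule G_inv_C[OF w])
  have "{x \<in> C r. v k < x} \<subset> {x \<in> C r. k < x}"
    using \<open>k < v k\<close> vr by (intro psubsetI) auto
  then have "lookup b (v k) < lookup b k"
    using r vr by (simp add: lookup_b_C psubset_card_mono)
  then show ?thesis
    unfolding less_monom_iff lookup_perm_monom[OF bij] v_def[symmetric]
    using below by (intro exI[of _ k]) simp
qed

lemma id_in_G: "id \<in> G"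
  by (simp add: G_iff permutes_id)

lemma perm_monom_id: "perm_monom id m = m"
  by (rule poly_mapping_eqI) (simp add: lookup_perm_monom)

text \<open>No other group element produces \<open>b\<close>, so the term of the identity cannot
  cancel.\<close>

lemma b_in_keys: "b \<in> keys \<Delta>"
proof -
  have "lookup \<Delta> b = (\<Sum>w\<in>G. if w = id then 1 else 0)"
    unfolding lookup_\<Delta>
  proof (rule sum.cong[OF refl])
    fix w assume "w \<in> G"
    then show "(if perm_monom w b = b then of_int (sign w) else 0 :: rat) = (if w = id then 1 else 0)"
      using perm_monom_b_less[of w] by (cases "w = id") (auto simp: perm_monom_id)
  qed
  also have "\<dots> = 1" using finite_G id_in_G by simp
  finally show ?thesis by (simp add: in_keys_iff)
qed

lemma keys_\<Delta>_le:
  assumes "m \<in> keys \<Delta>"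
  shows "m \<le> b"
proof -
  obtain w where "w \<in> G" "m = perm_monom w b" using keys_\<Delta>[OF assms] .
  then show ?thesis using perm_monom_b_less[of w] by (cases "w = id") (auto simp: perm_monom_id)
qed

text \<open>Composition with the transposition permutes G and flips all signs; m! is unchanged by
  permuting exponents.\<close>

lemma \<Delta>_antisymmetric:
  assumes "x \<in> C r" "y \<in> C r" "x \<noteq> y"
  shows "dcoef \<Delta> (perm_monom (transpose x y) m) = - dcoef \<Delta> m"
proof -
  let ?t = "transpose x y"
  have t: "?t \<in> G" "bij ?t" "?t \<circ> ?t = id" using assms transpose_in_G by auto
  have "lookup \<Delta> (perm_monom ?t m) = - lookup \<Delta> m"
  proof -
    have "lookup \<Delta> m = (\<Sum>w\<in>G. if perm_monom (?t \<circ> w) b = m then of_int (sign (?t \<circ> w)) else 0)"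
      unfolding lookup_\<Delta>
      by (rule sum.reindex_bij_witness[of _ "\<lambda>w. ?t \<circ> w" "\<lambda>w. ?t \<circ> w"])
         (auto simp: G_comp t comp_assoc[symmetric])
    also have "\<dots> = (\<Sum>w\<in>G. - (if perm_monom w b = perm_monom ?t m then of_int (sign w) else 0))"
    proof (rule sum.cong[OF refl])
      fix w assume w: "w \<in> G"
      have "perm_monom (?t \<circ> w) b = m \<longleftrightarrow> perm_monom w b = perm_monom ?t m"
        using perm_monom_comp[of ?t w b] perm_monom_comp[of ?t ?t] t G_bij[OF w]
        by (metis perm_monom_id)
      moreover have "sign (?t \<circ> w) = - sign w"
        using sign_compose[of ?t w] G_sign[OF w] G_sign[OF t(1)] assms(3) by (simp add: sign_swap_id)
      ultimately show "(if perm_monom (?t \<circ> w) b = m then of_int (sign (?t \<circ> w)) else 0) =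
          - (if perm_monom w b = perm_monom ?t m then of_int (sign w) else 0 :: rat)"
        by simp
    qed
    finally show ?thesis by (simp add: lookup_\<Delta> sum_negf)
  qed
  then show ?thesis by (simp add: dcoef_def mfact_perm_monom)
qed

text \<open>
  As \<open>e\<^sub>d(S)\<close> is symmetric in the variables of a row contained in \<open>S\<close>, the derivative is still
  antisymmetric in them.
\<close>

lemma exponents_distinct:
  assumes S: "finite S" "C r \<subseteq> S" and m: "m \<in> keys (poly_diff (elem_sym d S) \<Delta>)"
  shows "inj_on (lookup m) (C r)"
proof (rule inj_onI, rule ccontr)
  fix x y assume xy: "x \<in> C r" "y \<in> C r" "lookup m x = lookup m y" "x \<noteq> y"
  let ?t = "transpose x y" and ?A = "{M. M \<subseteq> S \<and> card M = d}"
  have bij: "bij ?t" by simp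
  have fin: "finite M" if "M \<in> ?A" for M using that S(1) by (auto intro: finite_subset)
  \<comment> \<open>With m fixed, the transposition merely permutes the sets M, so the coefficient
    equals its own negative.\<close>
  have "perm_monom ?t m = m"
    using xy(3) by (intro poly_mapping_eqI) (auto simp: lookup_perm_monom transpose_def)
  then have *: "perm_monom ?t (m + indicator_monom M) = m + indicator_monom (?t ` M)" if "M \<in> ?A" for M
    using perm_monom_add[OF bij, of m] perm_monom_indicator[OF bij fin[OF that]] by simp
  have img: "?t ` M \<in> ?A" if "M \<in> ?A" for M
  proof -
    have "?t ` M \<subseteq> S" using that xy S(2) by (auto simp: transpose_def)
    then show ?thesis using that by (simp add: card_image inj_on_subset[OF bij_is_inj[OF bij]])
  qed
  have "dcoef (poly_diff (elem_sym d S) \<Delta>) m = (\<Sum>M\<in>?A. dcoef \<Delta> (m + indicator_monom (?t ` M)))"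
    unfolding dcoef_elem_sym[OF S(1)]
    by (rule sum.reindex_bij_witness[of _ "image ?t" "image ?t"])
       (use img in \<open>auto simp: image_comp\<close>)
  also have "\<dots> = (\<Sum>M\<in>?A. - dcoef \<Delta> (m + indicator_monom M))"
    by (rule sum.cong[OF refl]) (simp add: *[symmetric] \<Delta>_antisymmetric[OF xy(1,2,4)] del: dcoef_eq_0_iff)
  also have "\<dots> = - dcoef (poly_diff (elem_sym d S) \<Delta>) m"
    by (simp add: dcoef_elem_sym[OF S(1)] sum_negf)
  finally have "dcoef (poly_diff (elem_sym d S) \<Delta>) m = 0" by simp
  with m show False by simp
qed

section \<open>Harmonicity of the signed sum\<close>

lemma lam_le_n: "p < length lam \<Longrightarrow> lam ! p \<le> n"
  using OP_on_card[OF \<sigma>, of p] card_mono[OF _ OP_on_block_subset[OF \<sigma>], of p] by simp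

text \<open>Rows not inside S each own an element outside S, and rows are disjoint, so there are at
  most |[n] - S| of them. Hence at least \<lambda>_p - |[n] - S| rows meeting column p lie inside S;
  summing over p counts the boxes of the rows inside S.\<close>

lemma tail_le_rows:
  assumes "S \<subseteq> {1..n}"
  shows "tail lam (card ({1..n} - S)) \<le> (\<Sum>r | r \<in> {1..n} \<and> C r \<subseteq> S. card (C r))"
proof -
  let ?R = "{r. r \<in> {1..n} \<and> C r \<subseteq> S}" and ?c = "card ({1..n} - S)"
  have "lam ! p - ?c \<le> (\<Sum>r\<in>?R. if r \<le> lam ! p then 1 else 0)" if "p < length lam" for p
  proof -
    let ?B = "{r \<in> {1..lam ! p}. \<not> C r \<subseteq> S}"
    define f where "f r = (SOME x. x \<in> C r - S)" for r
    have f: "f r \<in> C r - S" if "r \<in> ?B" for r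
    proof -
      have "\<exists>x. x \<in> C r - S" using that by blast
      then show ?thesis unfolding f_def by (rule someI_ex)
    qed
    have "card ?B \<le> ?c"
    proof (rule card_inj_on_le)
      show "inj_on f ?B"
      proof (rule inj_onI)
        fix r t assume "r \<in> ?B" "t \<in> ?B" "f r = f t"
        then have "f r \<in> C r" "f r \<in> C t" using f[of r] f[of t] by simp_all
        then show "r = t" by (rule C_disjoint)
      qed
      show "f ` ?B \<subseteq> {1..n} - S"
      proof (rule image_subsetI)
        fix r assume "r \<in> ?B"
        from f[OF this] show "f r \<in> {1..n} - S" using subsetD[OF C_subset, of "f r" r] by blast
      qed
    qed simp
    moreover have "card {1..lam ! p} \<le> card (?B \<union> {r \<in> ?R. r \<le> lam ! p})"
      using lam_le_n[OF that] by (intro card_mono) auto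
    then have "lam ! p \<le> card ?B + card {r \<in> ?R. r \<le> lam ! p}"
      using card_Un_le[of ?B "{r \<in> ?R. r \<le> lam ! p}"] by (simp only: card_atLeastAtMost)
    moreover have "(\<Sum>r\<in>?R. if r \<le> lam ! p then 1 else 0) = card {r \<in> ?R. r \<le> lam ! p}"
    proof -
      have "?R \<inter> {r. r \<le> lam ! p} = {r \<in> ?R. r \<le> lam ! p}" by blast
      then show ?thesis by (simp add: sum.If_cases)
    qed
    ultimately show ?thesis by linarith
  qed
  then have "tail lam ?c \<le> (\<Sum>p<length lam. \<Sum>r\<in>?R. if r \<le> lam ! p then 1 else 0)"
    unfolding tail_def by (intro sum_mono) simp
  also have "\<dots> = (\<Sum>r\<in>?R. \<Sum>p<length lam. if r \<le> lam ! p then 1 else 0)"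
    by (rule sum.swap)
  also have "\<dots> = (\<Sum>r\<in>?R. card (C r))"
  proof (rule sum.cong[OF refl])
    fix r assume "r \<in> ?R"
    moreover have "{..<length lam} \<inter> {p. r \<le> lam ! p} = {p. p < length lam \<and> r \<le> lam ! p}" by auto
    ultimately show "(\<Sum>p<length lam. if r \<le> lam ! p then 1 else 0) = card (C r)"
      by (simp add: card_C conjugate_def sum.If_cases)
  qed
  finally show ?thesis .
qed

text \<open>Suppose a monomial m survives, with m + 1_M a permutation of \<open>b\<close>. On a row
  inside S the exponents of m are distinct, while those of \<open>b\<close> already have the minimal
  sum, so M avoids the row. Then |M| plus the sizes of these rows is at most |S|, against the degree
  bound.\<close>

lemma elem_sym_annihilates_\<Delta>:
  assumes S: "S \<subseteq> {1..n}" and d: "card S < d + tail lam (card ({1..n} - S))"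
  shows "poly_diff (elem_sym d S) \<Delta> = 0"
proof (rule ccontr)
  assume "poly_diff (elem_sym d S) \<Delta> \<noteq> 0"
  then obtain m where m: "m \<in> keys (poly_diff (elem_sym d S) \<Delta>)" by fastforce
  have fin: "finite S" using S by (rule finite_subset) simp
  have "dcoef (poly_diff (elem_sym d S) \<Delta>) m \<noteq> 0" using m by simp
  then obtain M where M: "M \<subseteq> S" "card M = d" "dcoef \<Delta> (m + indicator_monom M) \<noteq> 0"
    unfolding dcoef_elem_sym[OF fin] by (smt (verit, best) mem_Collect_eq sum.neutral)
  have finM: "finite M" using M(1) fin by (rule finite_subset)
  obtain w where w: "w \<in> G" "m + indicator_monom M = perm_monom w b"
    using M(3) keys_\<Delta> by auto
  let ?R = "{r. r \<in> {1..n} \<and> C r \<subseteq> S}"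
  have "M \<inter> C r = {}" if "C r \<subseteq> S" for r
  proof -
    have "\<Sum>{..<card (C r)} = (\<Sum>i\<in>C r. lookup b i)" by (simp add: sum_b_C)
    also have "\<dots> = (\<Sum>i\<in>C r. lookup (perm_monom w b) i)"
    proof (rule sum.reindex_bij_witness[of _ "pinv w" w])
      fix i assume i: "i \<in> C r"
      show "pinv w (w i) = i" "w (pinv w i) = i"
        using G_bij[OF w(1)] by (simp_all add: bij_is_inj bij_is_surj surj_f_inv_f)
      show "w i \<in> C r" using w(1) i by (auto simp: G_iff)
      show "pinv w i \<in> C r" by (rule G_inv_C[OF w(1) i])
      show "lookup (perm_monom w b) (w i) = lookup b i"
        using G_bij[OF w(1)] by (simp add: lookup_perm_monom bij_is_inj)
    qed
    also have "\<dots> = (\<Sum>i\<in>C r. lookup m i) + (\<Sum>i\<in>C r. lookup (indicator_monom M) i)"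
      by (simp add: w(2)[symmetric] lookup_add sum.distrib)
    also have "(\<Sum>i\<in>C r. lookup (indicator_monom M) i) = card (C r \<inter> M)"
      by (simp add: lookup_indicator_monom[OF finM] sum.If_cases)
    also have "(\<Sum>i\<in>C r. lookup m i) = \<Sum>(lookup m ` C r)"
      using exponents_distinct[OF fin that m] by (simp add: sum.reindex)
    finally have "\<Sum>{..<card (C r)} = \<Sum>(lookup m ` C r) + card (C r \<inter> M)" .
    moreover have "\<Sum>{..<card (C r)} \<le> \<Sum>(lookup m ` C r)"
      using sum_distinct_ge[of "lookup m ` C r"] card_image[OF exponents_distinct[OF fin that m]] by simp
    ultimately have "card (C r \<inter> M) = 0" by linarith
    then show ?thesis by (auto simp: card_eq_0_iff)
  qed
  then have "M \<inter> (\<Union>r\<in>?R. C r) = {}" by blast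
  then have "card M + card (\<Union>r\<in>?R. C r) = card (M \<union> (\<Union>r\<in>?R. C r))"
    using finM by (intro card_Un_disjoint[symmetric]) auto
  also have "\<dots> \<le> card S" using M(1) fin by (intro card_mono) auto
  also have "card (\<Union>r\<in>?R. C r) = (\<Sum>r\<in>?R. card (C r))"
    by (rule card_UN_disjoint) (use C_disjoint in auto)
  finally show False using tail_le_rows[OF S] d M(2) by linarith
qed

lemma maxcode_le: "i \<in> {1..n} \<Longrightarrow> maxcode lam \<sigma> i < length lam"
proof (cases "floating lam \<sigma> i")
  case False
  assume i: "i \<in> {1..n}"
  then obtain r where r: "i \<in> C r" using False floating_iff[OF _ \<sigma> i] by auto
  then have "1 \<le> r" using C_0 by (cases r) auto
  have "{x \<in> C r. i < x} \<subset> C r" using r by auto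
  then have "card {x \<in> C r. i < x} < card (C r)" by (intro psubset_card_mono) simp_all
  also have "\<dots> \<le> length lam"
    unfolding card_C[OF \<open>1 \<le> r\<close>] conjugate_def
    using card_mono[of "{..<length lam}" "{p. p < length lam \<and> r \<le> lam ! p}"] by auto
  finally show ?thesis using maxcode_container_row[OF _ \<sigma> r] by simp
qed (use parts in \<open>simp add: maxcode_def\<close>)

lemma \<Delta>_harmonic: "\<Delta> \<in> harmonic_on {1..n} lam"
proof -
  have "\<Delta> \<in> polys_on {1..n}"
    unfolding polys_on_def mem_Collect_eq
  proof safe
    fix m i assume "m \<in> keys \<Delta>" "i \<in> keys m"
    then obtain w where w: "w \<in> G" "m = perm_monom w b" using keys_\<Delta> by blast
    then have "pinv w i \<in> {1..n}"
      using \<open>i \<in> keys m\<close> by (auto simp: in_keys_iff lookup_perm_monom G_bij lookup_b split: if_splits)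
    moreover have "w permutes {1..n}" using w(1) by (simp add: G_iff)
    ultimately have "w (pinv w i) \<in> {1..n}" by (simp only: permutes_in_image)
    then show "i \<in> {1..n}" using G_bij[OF w(1)] by (simp add: bij_is_surj surj_f_inv_f)
  qed
  \<comment> \<open>All exponents in \<Delta> are values of maxcode or 0, hence below s.\<close>
  moreover have "poly_diff (Var i ^ length lam) \<Delta> = 0" for i
  proof (rule dcoef_eqI)
    fix a
    have "a + single i (length lam) \<notin> keys \<Delta>"
    proof
      assume "a + single i (length lam) \<in> keys \<Delta>"
      then obtain w where w: "w \<in> G" "a + single i (length lam) = perm_monom w b" using keys_\<Delta> by blast
      have "length lam \<le> lookup (a + single i (length lam)) i" by (simp add: lookup_add)
      also have "\<dots> = lookup b (pinv w i)" using w by (simp add: lookup_perm_monom G_bij)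
      also have "\<dots> < length lam" using maxcode_le parts by (simp add: lookup_b)
      finally show False by simp
    qed
    then show "dcoef (poly_diff (Var i ^ length lam) \<Delta>) a = dcoef 0 a"
      by (simp add: Var_power dcoef_poly_diff_single)
  qed
  ultimately show ?thesis
    using elem_sym_annihilates_\<Delta> by (simp add: harmonic_on_def)
qed

section \<open>The polynomials \<open>delta\<close>\<close>

lemma delta_harmonic: "delta n lam \<sigma> \<in> harmonic_on {1..n} lam"
  unfolding delta_def by (rule harmonic_on_poly_diff[OF \<Delta>_harmonic])

text \<open>Differentiation by x^e shifts all exponents down by e = maxcode - code and the order is
  translation invariant, so the leading exponent drops from \<open>b\<close> to the code. The
  truncated subtraction in e is exact since codes are bounded by maxcode.\<close>

lemma leading_monomial_delta:
  shows "delta n lam \<sigma> \<noteq> 0"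
    and "i \<in> {1..n} \<Longrightarrow> lookup (Max (keys (delta n lam \<sigma>))) i = code_on lam \<sigma> i"
proof -
  let ?c = "code n lam \<sigma>" and ?a = "maxcode lam \<sigma>"
  define c where "c = (\<Sum>i\<in>{1..n}. single i (?c i))"
  define e where "e = (\<Sum>i\<in>{1..n}. single i (?a i - ?c i))"
  have code: "?c i = code_on lam \<sigma> i" for i
    using \<sigma> by (intro code_eq_code_on) (simp add: OP_eq_OP_on)
  have "?c i \<le> ?a i" if "i \<in> {1..n}" for i
    unfolding code by (rule code_le_maxcode[OF _ \<sigma> that]) simp
  then have ce: "c + e = b"
    by (intro poly_mapping_eqI)
       (simp add: c_def e_def b_def lookup_add lookup_sum lookup_single when_def)
  have d: "dcoef (delta n lam \<sigma>) m = dcoef \<Delta> (m + e)" for m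
    unfolding delta_def by (simp add: prod_Var_power dcoef_poly_diff_single e_def)
  have c: "c \<in> keys (delta n lam \<sigma>)"
    using d[of c] dcoef_eq_0_iff[of "delta n lam \<sigma>" c] b_in_keys ce by simp
  then show "delta n lam \<sigma> \<noteq> 0" by auto
  have "Max (keys (delta n lam \<sigma>)) = c"
  proof (rule Max_eqI[OF _ _ c])
    fix m assume "m \<in> keys (delta n lam \<sigma>)"
    then have "m + e \<in> keys \<Delta>" using d[of m] dcoef_eq_0_iff[of "delta n lam \<sigma>" m] by simp
    then have "m + e \<le> c + e" using keys_\<Delta>_le ce by simp
    then show "m \<le> c" by (simp only: add_le_cancel_right)
  qed simp
  then show "lookup (Max (keys (delta n lam \<sigma>))) i = code_on lam \<sigma> i" if "i \<in> {1..n}"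
    using that by (simp add: c_def code lookup_sum lookup_single when_def)
qed

end

section \<open>Bases from leading monomials\<close>

text \<open>In a relation, the largest leading monomial among the terms with nonzero coefficient
  occurs in one term only.\<close>

lemma independent_distinct_leading_monomials:
  assumes "0 \<notin> B" "inj_on (\<lambda>f. Max (keys f)) B"
  shows "mpoly_vs.independent B"
proof
  assume "mpoly_vs.dependent B"
  then obtain t u where t: "finite t" "t \<subseteq> B" "(\<Sum>v\<in>t. scale (u v) v) = 0" "\<exists>v\<in>t. u v \<noteq> 0"
    unfolding mpoly_vs.dependent_explicit by blast
  let ?L = "\<lambda>f :: mpoly. Max (keys f)" and ?t = "{v \<in> t. u v \<noteq> 0}"
  have fin: "finite (?L ` ?t)" and ne: "?L ` ?t \<noteq> {}" using t by auto
  obtain w where w: "w \<in> ?t" "?L w = Max (?L ` ?t)"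
    using Max_in[OF fin ne] by (metis (no_types, lifting) imageE)
  have "w \<noteq> 0" using w t(2) assms(1) by blast
  then have "?L w \<in> keys w" by (intro Max_in) auto
  have "scale (u v) v = 0 \<or> lookup v (?L w) = 0" if "v \<in> t - {w}" for v
  proof (cases "u v = 0")
    case False
    then have v: "v \<in> ?t" using that by simp
    then have "?L v \<le> ?L w" unfolding w(2) using fin by (intro Max_ge) auto
    moreover have "?L v \<noteq> ?L w" using assms(2) v w(1) t(2) that by (auto dest: inj_onD)
    ultimately have "?L v < ?L w" by simp
    then have "?L w \<notin> keys v" using leD[OF Max_ge[OF finite_keys]] by blast
    then show ?thesis by (simp add: in_keys_iff)
  qed simp
  then have "lookup (scale (u v) v) (?L w) = 0" if "v \<in> t - {w}" for v
    using that by (fastforce simp: lookup_scale)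
  then have "(\<Sum>v\<in>t - {w}. lookup (scale (u v) v) (?L w)) = 0"
    by (rule sum.neutral[OF ballI])
  then have "(\<Sum>v\<in>t. lookup (scale (u v) v) (?L w)) = lookup (scale (u w) w) (?L w)"
    using w(1) by (subst sum.remove[OF t(1), of w]) simp_all
  moreover have "lookup (\<Sum>v\<in>t. scale (u v) v) (?L w) = 0" by (simp only: t(3) lookup_zero)
  then have "(\<Sum>v\<in>t. lookup (scale (u v) v) (?L w)) = 0" by (simp only: lookup_sum)
  ultimately have "u w * lookup w (?L w) = 0" by (simp only: lookup_scale)
  then show False using w(1) \<open>?L w \<in> keys w\<close> by (simp add: in_keys_iff)
qed

lemma span_leading_monomials:
  assumes V: "mpoly_vs.subspace V" and B: "finite B" "B \<subseteq> V"
    and lead: "\<And>g. g \<in> V \<Longrightarrow> g \<noteq> 0 \<Longrightarrow> \<exists>f\<in>B. f \<noteq> 0 \<and> Max (keys f) = Max (keys g)"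
  shows "mpoly_vs.span B = V"
proof
  let ?L = "\<lambda>f :: mpoly. Max (keys f)"
  show "mpoly_vs.span B \<subseteq> V" by (rule mpoly_vs.span_minimal[OF B(2) V])
  show "V \<subseteq> mpoly_vs.span B"
  proof
    fix g assume "g \<in> V"
    then show "g \<in> mpoly_vs.span B"
    proof (induction "card {c \<in> ?L ` B. c < ?L g}" arbitrary: g rule: less_induct)
      case less
      show ?case
      proof (cases "g = 0")
        case False
        then obtain f where f: "f \<in> B" "f \<noteq> 0" "?L f = ?L g" using lead less.prems by blast
        have inkeys: "?L g \<in> keys g" "?L f \<in> keys f"
          using False f(2) by (auto intro!: Max_in)
        define q where "q = lookup g (?L g) / lookup f (?L g)"
        define h where "h = g - scale q f"
        have hV: "h \<in> V"
          unfolding h_def using f(1) B(2) less.prems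
          by (intro mpoly_vs.subspace_diff[OF V] mpoly_vs.subspace_scale[OF V]) auto
        have "h \<in> mpoly_vs.span B"
        proof (cases "h = 0")
          case False
          then have hk: "?L h \<in> keys h" by (intro Max_in) auto
          have "lookup h (?L g) = 0"
            using inkeys(2) f(3) by (simp add: h_def q_def lookup_minus lookup_scale in_keys_iff)
          then have "?L h \<noteq> ?L g" using hk by (metis in_keys_iff)
          moreover have "?L h \<le> ?L g"
          proof -
            have "?L h \<in> keys g \<union> keys f"
              using hk keys_diff[of g "scale q f"] by (auto simp: h_def keys_scale split: if_splits)
            then show ?thesis using f(3) by (metis Max_ge UnE finite_keys)
          qed
          ultimately have lt: "?L h < ?L g" by simp
          have "{c \<in> ?L ` B. c < ?L h} \<subset> {c \<in> ?L ` B. c < ?L g}"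
          proof (rule psubsetI)
            obtain e where "e \<in> B" "?L e = ?L h" using lead[OF hV False] by blast
            then have "?L h \<in> {c \<in> ?L ` B. c < ?L g}" using lt by (metis (mono_tags, lifting) imageI mem_Collect_eq)
            then show "{c \<in> ?L ` B. c < ?L h} \<noteq> {c \<in> ?L ` B. c < ?L g}" by blast
          qed (use lt in auto)
          then have "card {c \<in> ?L ` B. c < ?L h} < card {c \<in> ?L ` B. c < ?L g}"
            using B(1) by (intro psubset_card_mono) auto
          then show ?thesis using less.hyps hV by blast
        qed (simp add: mpoly_vs.span_zero)
        then have "h + scale q f \<in> mpoly_vs.span B"
          using f(1) by (intro mpoly_vs.span_add mpoly_vs.span_scale) (auto intro: mpoly_vs.span_base)
        then show ?thesis by (simp add: h_def)
      qed (simp add: mpoly_vs.span_zero)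
    qed
  qed
qed

section \<open>Bases of the quotient ring\<close>

lemma carrier_R_ring: "carrier (R_ring n lam) = R_proj n lam ` polys n"
  unfolding R_ring_def R_proj_def FactRing_def by (auto simp: A_RCOSETS_def')

lemma ring_R_ring: "ring (R_ring n lam)"
  unfolding R_ring_def by (rule ideal.quotient_is_ring[OF ideal_I_ideal])

lemma R_proj_hom: "R_proj n lam \<in> ring_hom (poly_ring n) (R_ring n lam)"
proof -
  have "R_proj n lam = (+>\<^bsub>poly_ring n\<^esub>) (I_ideal n lam)" by (simp add: R_proj_def fun_eq_iff)
  then show ?thesis unfolding R_ring_def using ideal.rcos_ring_hom[OF ideal_I_ideal] by simp
qed

lemma R_proj_mult:
  "f \<in> polys n \<Longrightarrow> g \<in> polys n \<Longrightarrow> R_proj n lam f \<otimes>\<^bsub>R_ring n lam\<^esub> R_proj n lam g = R_proj n lam (f * g)"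
  using ring_hom_mult[OF R_proj_hom, of f n g lam] by simp

lemma R_proj_add:
  "f \<in> polys n \<Longrightarrow> g \<in> polys n \<Longrightarrow> R_proj n lam f \<oplus>\<^bsub>R_ring n lam\<^esub> R_proj n lam g = R_proj n lam (f + g)"
  using ring_hom_add[OF R_proj_hom, of f n g lam] by simp

lemma R_proj_eq: "R_proj n lam f = {h + f | h. h \<in> I_ideal n lam}"
  by (auto simp: R_proj_def a_r_coset_def')

lemma R_proj_0: "R_proj n lam 0 = \<zero>\<^bsub>R_ring n lam\<^esub>"
  by (simp add: R_proj_eq R_ring_def FactRing_def)

lemma R_proj_eq_iff: "R_proj n lam f = R_proj n lam g \<longleftrightarrow> f - g \<in> I_ideal n lam"
proof
  assume "R_proj n lam f = R_proj n lam g"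
  moreover have "f \<in> R_proj n lam f" using I_ideal_0 by (force simp: R_proj_eq)
  ultimately show "f - g \<in> I_ideal n lam" by (auto simp: R_proj_eq)
next
  assume fg: "f - g \<in> I_ideal n lam"
  have gf: "g - f \<in> I_ideal n lam" using I_ideal_scale[OF fg, of "-1"] by simp
  show "R_proj n lam f = R_proj n lam g"
    unfolding R_proj_eq
  proof safe
    fix h assume h: "h \<in> I_ideal n lam"
    show "\<exists>h'. h + f = h' + g \<and> h' \<in> I_ideal n lam"
      using I_ideal_add[OF h fg] by (intro exI[of _ "h + (f - g)"]) simp
    show "\<exists>h'. h + g = h' + f \<and> h' \<in> I_ideal n lam"
      using I_ideal_add[OF h gf] by (intro exI[of _ "h + (g - f)"]) simp
  qed
qed

lemma subspace_polys: "mpoly_vs.subspace (polys n)"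
  unfolding polys_eq_polys_on by (rule mpoly_vs.subspaceI) (simp_all add: polys_on_add polys_on_scale)

text \<open>Relates the span of lists over the field of constant cosets to the span in the
  polynomial space: line extension matches \<open>span_insert\<close>.\<close>

lemma Span_R_proj:
  assumes "set xs \<subseteq> polys n"
  shows "ring.Span (R_ring n lam) (R_proj n lam ` range Const) (map (R_proj n lam) xs) =
    R_proj n lam ` mpoly_vs.span (set xs)"
  using assms
proof (induction xs)
  case Nil
  then show ?case by (simp add: ring.Span.simps[OF ring_R_ring] R_proj_0)
next
  case (Cons x xs)
  let ?K = "R_proj n lam ` range Const" and ?R = "R_ring n lam"
  have x: "x \<in> polys n" and sub: "mpoly_vs.span (set xs) \<subseteq> polys n"
    using Cons.prems mpoly_vs.span_minimal[OF _ subspace_polys] by auto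
  have *: "R_proj n lam (Const c) \<otimes>\<^bsub>?R\<^esub> R_proj n lam x \<oplus>\<^bsub>?R\<^esub> R_proj n lam v = R_proj n lam (scale c x + v)"
    if "v \<in> mpoly_vs.span (set xs)" for c v
    using that x sub by (simp add: R_proj_mult R_proj_add Const_in_polys polys_closed scale_def subset_iff)
  have "ring.Span ?R ?K (map (R_proj n lam) (x # xs)) =
      ring.line_extension ?R ?K (R_proj n lam x) (R_proj n lam ` mpoly_vs.span (set xs))"
    using Cons by (simp add: ring.Span.simps[OF ring_R_ring])
  also have "\<dots> = R_proj n lam ` mpoly_vs.span (set (x # xs))"
  proof (rule Set.set_eqI)
    fix y
    have "y \<in> ring.line_extension ?R ?K (R_proj n lam x) (R_proj n lam ` mpoly_vs.span (set xs)) \<longleftrightarrow>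
        (\<exists>c. \<exists>v\<in>mpoly_vs.span (set xs). y = R_proj n lam (scale c x + v))"
      by (simp add: ring.line_extension_mem_iff[OF ring_R_ring] * cong: bex_cong)
    also have "\<dots> \<longleftrightarrow> (\<exists>f\<in>mpoly_vs.span (set (x # xs)). y = R_proj n lam f)"
    proof safe
      fix c v assume "v \<in> mpoly_vs.span (set xs)"
      then have "scale c x + v \<in> mpoly_vs.span (set (x # xs))"
        by (auto simp: mpoly_vs.span_insert intro!: exI[of _ c])
      then show "\<exists>f\<in>mpoly_vs.span (set (x # xs)). R_proj n lam (scale c x + v) = R_proj n lam f" by blast
    next
      fix f assume "f \<in> mpoly_vs.span (set (x # xs))"
      then obtain c where "f - scale c x \<in> mpoly_vs.span (set xs)"
        by (auto simp: mpoly_vs.span_insert)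
      then show "\<exists>c. \<exists>v\<in>mpoly_vs.span (set xs). R_proj n lam f = R_proj n lam (scale c x + v)"
        by (intro exI[of _ c] bexI[of _ "f - scale c x"]) simp_all
    qed
    finally show "y \<in> ring.line_extension ?R ?K (R_proj n lam x) (R_proj n lam ` mpoly_vs.span (set xs)) \<longleftrightarrow>
        y \<in> R_proj n lam ` mpoly_vs.span (set (x # xs))"
      by blast
  qed
  finally show ?case .
qed

text \<open>The projection is injective on V because V meets I only in 0.\<close>

lemma independent_R_proj:
  assumes "distinct xs" "mpoly_vs.independent (set xs)" "set xs \<subseteq> harmonic_space n lam"
    and V: "mpoly_vs.subspace (harmonic_space n lam)"
  shows "ring.independent (R_ring n lam) (R_proj n lam ` range Const) (map (R_proj n lam) xs)"
  using assms(1-3)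
proof (induction xs)
  case Nil
  then show ?case by (simp add: ring.li_Nil[OF ring_R_ring])
next
  case (Cons x xs)
  have polys: "set (x # xs) \<subseteq> polys n" using Cons.prems(3) by (auto simp: harmonic_space_def)
  have ind: "mpoly_vs.independent (set xs)" "x \<notin> mpoly_vs.span (set xs)"
    using Cons.prems(1,2) by (simp_all add: mpoly_vs.independent_insert)
  have "R_proj n lam x \<notin> R_proj n lam ` mpoly_vs.span (set xs)"
  proof
    assume "R_proj n lam x \<in> R_proj n lam ` mpoly_vs.span (set xs)"
    then obtain v where v: "v \<in> mpoly_vs.span (set xs)" "x - v \<in> I_ideal n lam"
      by (auto simp: R_proj_eq_iff)
    have "v \<in> harmonic_space n lam"
      using v(1) mpoly_vs.span_minimal[OF _ V, of "set xs"] Cons.prems(3) by auto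
    then have "x - v \<in> harmonic_space n lam"
      using Cons.prems(3) by (intro mpoly_vs.subspace_diff[OF V]) auto
    then have "x - v = 0" using ideal_inter_harmonic[OF v(2)] by simp
    then show False using v(1) ind(2) by simp
  qed
  then have "R_proj n lam x \<notin> ring.Span (R_ring n lam) (R_proj n lam ` range Const) (map (R_proj n lam) xs)"
    using polys by (subst Span_R_proj) auto
  moreover have "R_proj n lam x \<in> carrier (R_ring n lam)"
    using polys by (auto simp: carrier_R_ring)
  ultimately show ?case
    using Cons.IH Cons.prems ind(1) by (auto intro: ring.li_Cons[OF ring_R_ring])
qed

text \<open>Spanning comes from V + I being the whole ring: every coset has a harmonic
  representative.\<close>

lemma R_basis_harmonic:
  assumes B: "finite B" "mpoly_vs.independent B" "mpoly_vs.span B = harmonic_space n lam"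
    and lam: "0 < length lam"
  shows "R_basis n lam (R_proj n lam ` B)"
proof -
  obtain xs where xs: "set xs = B" "distinct xs" using finite_distinct_list[OF B(1)] by blast
  have V: "mpoly_vs.subspace (harmonic_space n lam)"
    using mpoly_vs.subspace_span[of B] by (simp add: B(3))
  have BV: "B \<subseteq> harmonic_space n lam" using mpoly_vs.span_superset[of B] by (simp add: B(3))
  have Vp: "harmonic_space n lam \<subseteq> polys n" by (auto simp: harmonic_space_def)
  have "R_proj n lam ` harmonic_space n lam = R_proj n lam ` polys n"
  proof
    show "R_proj n lam ` polys n \<subseteq> R_proj n lam ` harmonic_space n lam"
    proof (rule image_subsetI)
      fix f assume "f \<in> polys n"
      then obtain u where u: "u \<in> I_ideal n lam" "f - u \<in> harmonic_space n lam"
        using ideal_plus_harmonic[OF _ lam] by blast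
      have "R_proj n lam f = R_proj n lam (f - u)" using u(1) by (simp add: R_proj_eq_iff)
      with u(2) show "R_proj n lam f \<in> R_proj n lam ` harmonic_space n lam" by blast
    qed
  qed (use Vp in blast)
  then have "ring.Span (R_ring n lam) (R_proj n lam ` range Const) (map (R_proj n lam) xs) =
      carrier (R_ring n lam)"
    using BV Vp xs(1) B(3) by (subst Span_R_proj) (auto simp: carrier_R_ring)
  moreover have "ring.independent (R_ring n lam) (R_proj n lam ` range Const) (map (R_proj n lam) xs)"
    using xs B(2) BV V by (intro independent_R_proj) simp_all
  ultimately show ?thesis
    unfolding R_basis_def Let_def using xs(1) by (intro exI[of _ "map (R_proj n lam) xs"]) simp
qed

section \<open>The basis theorem\<close>

lemma finite_OP: "finite (OP n lam)"
proof (rule finite_subset)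
  show "OP n lam \<subseteq> {\<sigma>. set \<sigma> \<subseteq> Pow {1..n} \<and> length \<sigma> = length lam}"
    unfolding OP_eq_OP_on using OP_on_block_subset OP_on_length
    by (fastforce simp: in_set_conv_nth)
qed (simp add: finite_lists_length_eq)

theorem theorem4p8:
  fixes n k s :: nat and lam :: "nat list"
  assumes "0 < k" and "k \<le> n"
    and "partition_with_parts lam k s"
  shows "mpoly_vs.independent (delta n lam ` OP n lam) \<and>
         mpoly_vs.span (delta n lam ` OP n lam) = harmonic_space n lam \<and>
         R_basis n lam (R_proj n lam ` delta n lam ` OP n lam)"
proof -
  let ?B = "delta n lam ` OP n lam" and ?L = "\<lambda>f :: mpoly. Max (keys f)"
  have sum: "sum_list lam = k" using assms(3) by (simp add: partition_with_parts_def)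
  then have len: "0 < length lam" using assms(1) by (cases lam) auto
  have le: "lam ! p \<le> n" if "p < length lam" for p
    using elem_le_sum_list[OF that] sum assms(2) by simp
  have V: "harmonic_space n lam = harmonic_on {1..n} lam"
    by (rule harmonic_space_eq_harmonic_on[OF le])
  have osp: "ordered_set_partition n lam \<sigma>" if "\<sigma> \<in> OP n lam" for \<sigma>
    using that len by unfold_locales (simp_all add: OP_eq_OP_on)
  note delta = ordered_set_partition.delta_harmonic[OF osp]
    ordered_set_partition.leading_monomial_delta[OF osp]
  have code_inj: "\<sigma> = \<tau>" if "\<sigma> \<in> OP n lam" "\<tau> \<in> OP n lam" "?L (delta n lam \<sigma>) = ?L (delta n lam \<tau>)" for \<sigma> \<tau>
  proof (rule code_on_inj[of "{1..n}" _ lam])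
    show "code_on lam \<sigma> i = code_on lam \<tau> i" if "i \<in> {1..n}" for i
      using delta(3)[OF \<open>\<sigma> \<in> _\<close> that] delta(3)[OF \<open>\<tau> \<in> _\<close> that] \<open>?L (delta n lam \<sigma>) = _\<close> by simp
  qed (use that in \<open>simp_all add: OP_eq_OP_on\<close>)
  have ind: "mpoly_vs.independent ?B"
  proof (rule independent_distinct_leading_monomials)
    show "0 \<notin> ?B" using delta(2) by auto
    show "inj_on ?L ?B"
    proof (rule inj_onI)
      fix f g assume "f \<in> ?B" "g \<in> ?B" and eq: "?L f = ?L g"
      then obtain \<sigma> \<tau> where "\<sigma> \<in> OP n lam" "f = delta n lam \<sigma>" "\<tau> \<in> OP n lam" "g = delta n lam \<tau>" by blast
      then show "f = g" using code_inj[of \<sigma> \<tau>] eq by simp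
    qed
  qed
  have span: "mpoly_vs.span ?B = harmonic_space n lam"
    unfolding V
  proof (rule span_leading_monomials)
    show "?B \<subseteq> harmonic_on {1..n} lam" using delta(1) by blast
    fix g assume g: "g \<in> harmonic_on {1..n} lam" "g \<noteq> 0"
    obtain \<sigma> where \<sigma>: "\<sigma> \<in> OP n lam" "\<forall>i\<in>{1..n}. lookup (?L g) i = code_on lam \<sigma> i"
      using leading_monomial_harmonic_on[OF _ g] by (auto simp: OP_eq_OP_on)
    \<comment> \<open>Monomials have exponents at all natural numbers, while codes are compared only
      on [n]; outside, both leading monomials vanish.\<close>
    have vars: "lookup (?L f) i = 0" if "f \<in> harmonic_on {1..n} lam" "f \<noteq> 0" "i \<notin> {1..n}" for f i
    proof -
      have "?L f \<in> keys f" using that(2) by (intro Max_in) auto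
      then have "keys (?L f) \<subseteq> {1..n}" using that(1) by (auto simp: harmonic_on_def polys_on_def)
      then have "i \<notin> keys (?L f)" using that(3) by blast
      then show ?thesis by (simp add: in_keys_iff)
    qed
    have "?L (delta n lam \<sigma>) = ?L g"
    proof (rule poly_mapping_eqI)
      fix i
      show "lookup (?L (delta n lam \<sigma>)) i = lookup (?L g) i"
      proof (cases "i \<in> {1..n}")
        case True
        then show ?thesis using \<sigma>(2) delta(3)[OF \<sigma>(1) True] by simp
      next
        case False
        then show ?thesis using vars[OF g False] vars[OF delta(1,2)[OF \<sigma>(1)] False] by simp
      qed
    qed
    then show "\<exists>f\<in>?B. f \<noteq> 0 \<and> ?L f = ?L g" using \<sigma>(1) delta(2)[OF \<sigma>(1)] by blast
  qed (simp_all add: subspace_harmonic_on finite_OP)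
  have "R_basis n lam (R_proj n lam ` ?B)"
    by (rule R_basis_harmonic[OF _ ind span len]) (simp add: finite_OP)
  with ind span show ?thesis by simp
qed

end
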